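(* Assume that $K$ and $f$ are continuous non-negative functions defined on $\mathbb S^2\setminus\{\mathbf n\}$ such that: (1) for any $\theta,\theta'$ on the same geodesic passing through $\mathbf n$ and $\mathbf s$, $K(\theta)\ge K(\theta')$ if $\theta_3>\theta'_3$; (2) for any $\theta,\theta'$ on the same geodesic passing through $\mathbf n$ and $\mathbf s$, $f(\theta)\ge f(\theta')$ if $\theta_3>\theta'_3$; (3) $\left(f-\frac1{|\mathbb S^2|}\int_{\mathbb S^2}f\right)^2+\left(K-\frac1{|\mathbb S^2|}\int_{\mathbb S^2}K\right)^2$ is not identically zero, i.e. $f$ and $K$ are not both constant. If both $K$ and $f$ are rotationally symmetric about the line through $\mathbf n$ and $\mathbf s$, then any solution $v\in C^2(\mathbb S^2\setminus\{\mathbf n\})$ of $$-\Delta_{\mathbb S^2}v+1=K(\theta)e^{2v}+f(\theta)\quad\text{on }\mathbb S^2\setminus\{\mathbf n\}$$ satisfying $$\limsup_{\theta\to\mathbf n}\frac{v(\theta)}{\log d(\theta,\mathbf n)}\le0$$ must be rotationally symmetric about the line through $\mathbf n$ and $\mathbf s$.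
   Context: $\mathbb S^2\subset\mathbb R^3$ is the unit sphere with its standard metric, points written $\theta=(\theta_1,\theta_2,\theta_3)$; $\mathbf n=(0,0,1)$, $\mathbf s=(0,0,-1)$; $\Delta_{\mathbb S^2}$ is the Laplace–Beltrami operator and $d(\cdot,\cdot)$ the geodesic distance on $\mathbb S^2$. *)

theory Defs
  imports "HOL-Analysis.Analysis"
begin

abbreviation S2 :: "(real^3) set"
  where "S2 \<equiv> sphere 0 1"

definition north :: "real^3"
  where "north = vector [0, 0, 1]"

definition south :: "real^3"
  where "south = vector [0, 0, -1]"

text \<open>
  Length-minimizing definition of the Riemannian distance. The length is required to exist via
  \<open>has_integral\<close>: a \<open>valid_path\<close> may have a derivative of non-integrable norm, for which
  \<open>integral\<close> would be \<open>0\<close>.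
\<close>

definition geodesic_dist :: "real^3 \<Rightarrow> real^3 \<Rightarrow> real"
  where "geodesic_dist x y =
    Inf {L. \<exists>g. valid_path g \<and> path_image g \<subseteq> S2 \<and> pathstart g = x \<and> pathfinish g = y \<and>
            ((\<lambda>t. norm (vector_derivative g (at t within {0..1}))) has_integral L) {0..1}}"

text \<open>The complete geodesics of the round sphere, as point sets.\<close>

definition great_circle :: "(real^3) set \<Rightarrow> bool"
  where "great_circle C \<longleftrightarrow> (\<exists>P. subspace P \<and> dim P = 2 \<and> C = S2 \<inter> P)"

definition axially_symmetric_on :: "(real^3) set \<Rightarrow> (real^3 \<Rightarrow> real) \<Rightarrow> bool"
  where "axially_symmetric_on \<Omega> u \<longleftrightarrow>
    (\<forall>Q :: real^3^3. rotation_matrix Q \<and> Q *v north = north \<longrightarrow>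
       (\<forall>\<theta>\<in>\<Omega>. u (Q *v \<theta>) = u \<theta>))"

text \<open>
  Functions on the sphere are total functions on the ambient space, but are only differentiated
  within the sphere, so their values off it do not matter. A derivative within the sphere is
  determined only on the tangent plane \<open>{h. h \<bullet> \<theta> = 0}\<close>; below it is applied to tangent vectors
  only, so that the choice made by \<^const>\<open>frechet_derivative\<close> is immaterial.
\<close>

definition tangent_proj :: "real^3 \<Rightarrow> real^3 \<Rightarrow> real^3"
  where "tangent_proj \<theta> h = h - (h \<bullet> \<theta>) *\<^sub>R \<theta>"

definition sphere_deriv :: "(real^3 \<Rightarrow> 'b::real_normed_vector) \<Rightarrow> real^3 \<Rightarrow> real^3 \<Rightarrow> 'b"
  where "sphere_deriv F \<theta> h = frechet_derivative F (at \<theta> within S2) (tangent_proj \<theta> h)"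

definition sphere_grad :: "(real^3 \<Rightarrow> real) \<Rightarrow> real^3 \<Rightarrow> real^3"
  where "sphere_grad u \<theta> =
    (THE g. g \<bullet> \<theta> = 0 \<and> (u has_derivative (\<lambda>h. g \<bullet> h)) (at \<theta> within S2))"

text \<open>
  Trace over the tangent plane of the covariant derivative \<open>h \<mapsto> tangent_proj \<theta> (D\<^sub>h X)\<close>; since
  the derivative already vanishes in the normal direction, it may be computed in the standard
  basis of the ambient space, and the outer projection does not change it.
\<close>

definition sphere_div :: "(real^3 \<Rightarrow> real^3) \<Rightarrow> real^3 \<Rightarrow> real"
  where "sphere_div X \<theta> = (\<Sum>b\<in>Basis. sphere_deriv X \<theta> b \<bullet> b)"

definition laplace_beltrami :: "(real^3 \<Rightarrow> real) \<Rightarrow> real^3 \<Rightarrow> real"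
  where "laplace_beltrami u = sphere_div (sphere_grad u)"

text \<open>
  \<open>C\<^sup>2(\<Omega>)\<close> for \<open>\<Omega>\<close> relatively open in the sphere. Continuity of the first derivative follows from
  differentiability of the gradient.
\<close>

definition C2_on_sphere :: "(real^3) set \<Rightarrow> (real^3 \<Rightarrow> real) \<Rightarrow> bool"
  where "C2_on_sphere \<Omega> u \<longleftrightarrow>
    (\<forall>\<theta>\<in>\<Omega>. u differentiable (at \<theta> within S2)) \<and>
    (\<forall>\<theta>\<in>\<Omega>. sphere_grad u differentiable (at \<theta> within S2)) \<and>
    (\<forall>h. continuous_on \<Omega> (\<lambda>\<theta>. sphere_deriv (sphere_grad u) \<theta> h))"

end

theory Submission
  imports Defs
begin

text \<open>
  The proof is a moving plane argument in a well chosen chart. Stereographic projection from the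
  south pole puts the singular point, the north pole, at the origin and the regular south pole at
  infinity. With \<open>u = v + ln factor\<close>, where \<open>factor p = 2 / (1 + \<bar>p\<bar>\<^sup>2)\<close>, conformal invariance
  of the Laplacian (\<open>stereo_laplacian\<close>) turns the equation into
  \<open>- \<Delta> u = K exp (2 u) + factor\<^sup>2 f\<close> on the punctured plane. Since \<open>K\<close> and \<open>f\<close> increase towards
  the north pole, both coefficients are nonincreasing functions of \<open>\<bar>p\<bar>\<close>, which is exactly the sign
  that the method of moving planes requires. On the sphere the lines \<open>x = \<mu>\<close> are circles through
  the south pole; they start as small circles and end at \<open>\<mu> = 0\<close> as a vertical great circle.

  One shows that \<open>u\<close> dominates its reflection in each line \<open>x = \<mu>\<close>, \<open>\<mu> > 0\<close>, on the side of the
  origin. The difference, the gap, satisfies a linear differential inequality whose zeroth order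
  coefficient is of order \<open>\<bar>p\<bar> ^ (- 4)\<close> where the gap is negative. Comparison with one explicit
  positive function, which works both far out and in a narrow strip along the line
  (\<open>gap_barrier\<close>), confines a negative minimum to a bounded set that keeps a fixed distance from the
  line (\<open>narrow_region\<close>). On that set the gap is nonnegative for large \<open>\<mu>\<close> (\<open>dominated_start\<close>). If
  it is nonnegative for some \<open>\<mu> > 0\<close>, the strong minimum principle makes it positive (\<open>gap_pos\<close>), and
  then it stays nonnegative for slightly smaller \<open>\<mu>\<close> (\<open>dominated_open\<close>); the exception, a gap that
  vanishes identically, would force \<open>f = 0\<close> and \<open>K\<close> constant (\<open>nondegenerate\<close>). Near the origin
  \<open>u\<close> need not be bounded, but the growth condition says that it stays above every positive multiple
  of \<open>ln \<bar>p\<bar>\<close>, so that the singularity is removable for the minimum principle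
  (\<open>superharmonic_min_punctured_disc\<close>).

  In the limit \<open>\<mu> \<longlongrightarrow> 0\<close> one gets an inequality between \<open>v\<close> and its reflection in a vertical plane.
  The opposite direction of the same axis gives the reverse inequality, so \<open>v\<close> is invariant under
  all vertical reflections, hence under all rotations about the axis.
\<close>

section \<open>The Laplacian in the plane\<close>

text \<open>
  The minimum principles below only look at second derivatives at the point where a minimum is
  attained, so existence of the two pure second derivatives there is all that is recorded; first
  derivatives have to exist nearby for the mean value theorem to apply.
\<close>
definition has_second_derivative :: "(real \<Rightarrow> real) \<Rightarrow> real \<Rightarrow> real \<Rightarrow> bool"
  where "has_second_derivative \<phi> s t \<longleftrightarrow>
    (\<exists>\<phi>'. (\<forall>\<^sub>F x in nhds t. (\<phi> has_real_derivative \<phi>' x) (at x)) \<and>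
          (\<phi>' has_real_derivative s) (at t))"

definition has_laplacian :: "(real \<times> real \<Rightarrow> real) \<Rightarrow> real \<Rightarrow> real \<times> real \<Rightarrow> bool"
  where "has_laplacian u L p \<longleftrightarrow>
    (\<exists>a b. has_second_derivative (\<lambda>t. u (t, snd p)) a (fst p) \<and>
           has_second_derivative (\<lambda>t. u (fst p, t)) b (snd p) \<and> L = a + b)"

lemma has_second_derivativeI:
  assumes "open S" "t \<in> S" "\<And>x. x \<in> S \<Longrightarrow> (\<phi> has_real_derivative \<phi>' x) (at x)"
    and "(\<phi>' has_real_derivative s) (at t)"
  shows "has_second_derivative \<phi> s t"
  unfolding has_second_derivative_def eventually_nhds using assms by blast

lemma has_laplacianI:
  assumes "has_second_derivative (\<lambda>t. u (t, snd p)) a (fst p)"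
    and "has_second_derivative (\<lambda>t. u (fst p, t)) b (snd p)" and "L = a + b"
  shows "has_laplacian u L p"
  using assms unfolding has_laplacian_def by blast

lemma has_second_derivative_add:
  assumes "has_second_derivative \<phi> a t" "has_second_derivative \<psi> b t"
  shows "has_second_derivative (\<lambda>x. \<phi> x + \<psi> x) (a + b) t"
proof -
  obtain \<phi>' where 1: "\<forall>\<^sub>F x in nhds t. (\<phi> has_real_derivative \<phi>' x) (at x)"
    "(\<phi>' has_real_derivative a) (at t)"
    using assms(1) unfolding has_second_derivative_def by blast
  obtain \<psi>' where 2: "\<forall>\<^sub>F x in nhds t. (\<psi> has_real_derivative \<psi>' x) (at x)"
    "(\<psi>' has_real_derivative b) (at t)"
    using assms(2) unfolding has_second_derivative_def by blast
  show ?thesis unfolding has_second_derivative_def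
  proof (intro exI conjI)
    show "\<forall>\<^sub>F x in nhds t. ((\<lambda>x. \<phi> x + \<psi> x) has_real_derivative \<phi>' x + \<psi>' x) (at x)"
      using 1(1) 2(1) by eventually_elim (rule DERIV_add)
    show "((\<lambda>x. \<phi>' x + \<psi>' x) has_real_derivative a + b) (at t)"
      using 1(2) 2(2) by (rule DERIV_add)
  qed
qed

lemma has_second_derivative_cmult:
  assumes "has_second_derivative \<phi> a t"
  shows "has_second_derivative (\<lambda>x. c * \<phi> x) (c * a) t"
proof -
  obtain \<phi>' where 1: "\<forall>\<^sub>F x in nhds t. (\<phi> has_real_derivative \<phi>' x) (at x)"
    "(\<phi>' has_real_derivative a) (at t)"
    using assms(1) unfolding has_second_derivative_def by blast
  show ?thesis unfolding has_second_derivative_def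
  proof (intro exI conjI)
    show "\<forall>\<^sub>F x in nhds t. ((\<lambda>x. c * \<phi> x) has_real_derivative c * \<phi>' x) (at x)"
      using 1(1) by eventually_elim (rule DERIV_cmult)
    show "((\<lambda>x. c * \<phi>' x) has_real_derivative c * a) (at t)"
      using 1(2) by (rule DERIV_cmult)
  qed
qed

lemma has_second_derivative_reflect:
  assumes "has_second_derivative \<phi> a (c - t)"
  shows "has_second_derivative (\<lambda>x. \<phi> (c - x)) a t"
proof -
  obtain \<phi>' where 1: "\<forall>\<^sub>F x in nhds (c - t). (\<phi> has_real_derivative \<phi>' x) (at x)"
    "(\<phi>' has_real_derivative a) (at (c - t))"
    using assms(1) unfolding has_second_derivative_def by blast
  have lim: "filterlim (\<lambda>x. c - x) (nhds (c - t)) (nhds t)"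
    by (intro tendsto_intros filterlim_ident)
  have d: "((\<lambda>x. c - x) has_real_derivative -1) (at x)" for x
    by (auto intro!: derivative_eq_intros)
  show ?thesis unfolding has_second_derivative_def
  proof (intro exI conjI)
    have "\<forall>\<^sub>F x in nhds t. (\<phi> has_real_derivative \<phi>' (c - x)) (at (c - x))"
      using 1(1) lim by (rule eventually_compose_filterlim)
    then show "\<forall>\<^sub>F x in nhds t. ((\<lambda>x. \<phi> (c - x)) has_real_derivative - \<phi>' (c - x)) (at x)"
    proof eventually_elim
      case (elim x)
      show ?case using DERIV_chain2[OF elim d] by simp
    qed
    show "((\<lambda>x. - \<phi>' (c - x)) has_real_derivative a) (at t)"
      using DERIV_minus[OF DERIV_chain2[OF 1(2) d]] by simp
  qed
qed

lemma has_second_derivative_local_min: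
  assumes "has_second_derivative \<phi> s t" and "\<forall>\<^sub>F x in nhds t. \<phi> t \<le> \<phi> x"
  shows "s \<ge> 0"
proof (rule ccontr)
  assume "\<not> s \<ge> 0"
  obtain \<phi>' where 1: "\<forall>\<^sub>F x in nhds t. (\<phi> has_real_derivative \<phi>' x) (at x)"
    "(\<phi>' has_real_derivative s) (at t)"
    using assms(1) unfolding has_second_derivative_def by blast
  obtain d where d: "d > 0" "\<And>x. dist x t < d \<Longrightarrow> (\<phi> has_real_derivative \<phi>' x) (at x)"
    "\<And>x. dist x t < d \<Longrightarrow> \<phi> t \<le> \<phi> x"
    using eventually_conj[OF 1(1) assms(2)] unfolding eventually_nhds_metric by auto
  have "\<phi>' t = 0"
    using DERIV_local_min[OF d(2) d(1)] d(1,3) by (simp add: dist_real_def abs_minus_commute)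
  moreover obtain e where e: "e > 0" "\<And>h. 0 < h \<Longrightarrow> h < e \<Longrightarrow> \<phi>' (t + h) < \<phi>' t"
    using DERIV_neg_dec_right[OF 1(2)] \<open>\<not> s \<ge> 0\<close> by auto
  define h where "h = min d e / 2"
  have h: "0 < h" "h < d" "h < e" using d(1) e(1) by (auto simp: h_def)
  obtain z where z: "t < z" "z < t + h" "\<phi> (t + h) - \<phi> t = (t + h - t) * \<phi>' z"
    using MVT2[of t "t + h" \<phi> \<phi>'] d(2) h by (auto simp: dist_real_def)
  have "\<phi>' z < 0" using e(2)[of "z - t"] z h \<open>\<phi>' t = 0\<close> by auto
  then have "h * \<phi>' z < 0" using h by (simp add: mult_pos_neg)
  then have "\<phi> (t + h) < \<phi> t" using z(3) by simp
  moreover have "\<phi> t \<le> \<phi> (t + h)" using d(3)[of "t + h"] h by (simp add: dist_real_def)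
  ultimately show False by simp
qed

lemma has_laplacian_add:
  assumes "has_laplacian u a p" "has_laplacian w b p"
  shows "has_laplacian (\<lambda>q. u q + w q) (a + b) p"
proof -
  obtain a1 a2 where a: "has_second_derivative (\<lambda>t. u (t, snd p)) a1 (fst p)"
    "has_second_derivative (\<lambda>t. u (fst p, t)) a2 (snd p)" "a = a1 + a2"
    using assms(1) unfolding has_laplacian_def by blast
  obtain b1 b2 where b: "has_second_derivative (\<lambda>t. w (t, snd p)) b1 (fst p)"
    "has_second_derivative (\<lambda>t. w (fst p, t)) b2 (snd p)" "b = b1 + b2"
    using assms(2) unfolding has_laplacian_def by blast
  show ?thesis unfolding has_laplacian_def
    using has_second_derivative_add[OF a(1) b(1)] has_second_derivative_add[OF a(2) b(2)] a(3) b(3)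
    by (intro exI[of _ "a1 + b1"] exI[of _ "a2 + b2"]) auto
qed

lemma has_laplacian_cmult:
  assumes "has_laplacian u a p"
  shows "has_laplacian (\<lambda>q. c * u q) (c * a) p"
  using assms unfolding has_laplacian_def
  by (metis distrib_left has_second_derivative_cmult)

lemma has_laplacian_diff:
  assumes "has_laplacian u a p" "has_laplacian w b p"
  shows "has_laplacian (\<lambda>q. u q - w q) (a - b) p"
  using has_laplacian_add[OF assms(1) has_laplacian_cmult[OF assms(2), of "-1"]] by simp

lemma has_laplacian_const: "has_laplacian (\<lambda>q. c) 0 p"
proof -
  have "has_second_derivative (\<lambda>t. c) 0 t" for t
    by (rule has_second_derivativeI[of UNIV _ _ "\<lambda>_. 0"]) auto
  then show ?thesis unfolding has_laplacian_def by force
qed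

lemma has_laplacian_reflect:
  assumes "has_laplacian u a (c - fst p, snd p)"
  shows "has_laplacian (\<lambda>q. u (c - fst q, snd q)) a p"
  using assms has_second_derivative_reflect[of "\<lambda>t. u (t, snd p)" _ c "fst p"]
  unfolding has_laplacian_def by auto

text \<open>
  The source of every comparison argument below: a strictly superharmonic function has no interior
  minimum.
\<close>
lemma has_laplacian_local_min:
  assumes "has_laplacian u L p" and "open S" "p \<in> S" "\<And>q. q \<in> S \<Longrightarrow> u p \<le> u q"
  shows "L \<ge> 0"
proof -
  obtain a b where ab: "has_second_derivative (\<lambda>t. u (t, snd p)) a (fst p)"
    "has_second_derivative (\<lambda>t. u (fst p, t)) b (snd p)" "L = a + b"
    using assms(1) unfolding has_laplacian_def by blast
  have ev: "\<forall>\<^sub>F q in nhds p. u p \<le> u q" using assms(2-4) eventually_nhds by blast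
  have "filterlim (\<lambda>t. (t, snd p)) (nhds p) (nhds (fst p))"
    using tendsto_Pair[OF filterlim_ident tendsto_const, of "snd p" "fst p"] by simp
  from eventually_compose_filterlim[OF ev this] have "a \<ge> 0"
    by (intro has_second_derivative_local_min[OF ab(1)]) simp
  have "filterlim (\<lambda>t. (fst p, t)) (nhds p) (nhds (snd p))"
    using tendsto_Pair[OF tendsto_const filterlim_ident, of "fst p" "snd p"] by simp
  from eventually_compose_filterlim[OF ev this] have "b \<ge> 0"
    by (intro has_second_derivative_local_min[OF ab(2)]) simp
  with \<open>a \<ge> 0\<close> ab(3) show ?thesis by simp
qed

lemma norm_prod_sq: "(norm p)\<^sup>2 = (fst p)\<^sup>2 + (snd p)\<^sup>2" for p :: "real \<times> real"
  by (cases p) (simp add: norm_Pair)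

lemma has_second_derivative_power2: "has_second_derivative (\<lambda>t. t\<^sup>2 + c) 2 t"
  by (rule has_second_derivativeI[of UNIV _ _ "\<lambda>t. 2 * t"]) (auto intro!: derivative_eq_intros)

lemma has_laplacian_norm_sq: "has_laplacian (\<lambda>q. (norm q)\<^sup>2) 4 p"
  unfolding has_laplacian_def norm_prod_sq
  using has_second_derivative_power2[of "(snd p)\<^sup>2" "fst p"]
    has_second_derivative_power2[of "(fst p)\<^sup>2" "snd p"]
  by (intro exI[of _ 2]) (simp add: add.commute)

lemma has_second_derivative_ln:
  assumes "t\<^sup>2 + c > 0" "c \<ge> (0::real)"
  shows "has_second_derivative (\<lambda>t. ln (t\<^sup>2 + c)) (2 / (t\<^sup>2 + c) - 4 * t\<^sup>2 / (t\<^sup>2 + c)\<^sup>2) t"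
proof (rule has_second_derivativeI)
  show "open {t. t\<^sup>2 + c > 0}" by (intro open_Collect_less continuous_intros)
  show "((\<lambda>t. ln (t\<^sup>2 + c)) has_real_derivative 2 * x / (x\<^sup>2 + c)) (at x)"
    if "x \<in> {t. t\<^sup>2 + c > 0}" for x
    using that by (auto intro!: derivative_eq_intros simp: field_simps)
  have "((\<lambda>x. 2 * x / (x\<^sup>2 + c)) has_real_derivative
      (2 * (t\<^sup>2 + c) - 2 * t * (2 * t)) / ((t\<^sup>2 + c) * (t\<^sup>2 + c))) (at t)"
    using assms by (intro DERIV_divide) (auto intro!: derivative_eq_intros)
  also have "(2 * Q - 2 * t * (2 * t)) / (Q * Q) = 2 / Q - 4 * t\<^sup>2 / Q\<^sup>2" if "Q > 0" for Q
    using that by (simp add: field_simps power2_eq_square)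
  note this[OF assms(1)]
  finally show "((\<lambda>x. 2 * x / (x\<^sup>2 + c)) has_real_derivative
      2 / (t\<^sup>2 + c) - 4 * t\<^sup>2 / (t\<^sup>2 + c)\<^sup>2) (at t)" .
qed (use assms in auto)

text \<open>The shift \<open>c\<close> serves both the fundamental solution (\<open>c = 0\<close>) and the conformal factor of the
  sphere (\<open>c = 1\<close>).\<close>
lemma has_laplacian_ln:
  assumes "(norm p)\<^sup>2 + c > 0" "c \<ge> 0"
  shows "has_laplacian (\<lambda>q. ln ((norm q)\<^sup>2 + c)) (4 * c / ((norm p)\<^sup>2 + c)\<^sup>2) p"
proof -
  let ?n = "(norm p)\<^sup>2 + c"
  have eq: "4 * c / ?n\<^sup>2 =
    (2 / ?n - 4 * (fst p)\<^sup>2 / ?n\<^sup>2) + (2 / ?n - 4 * (snd p)\<^sup>2 / ?n\<^sup>2)"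
  proof -
    have "2 / ?n = 2 * ?n / ?n\<^sup>2"
      using assms(1) mult_divide_mult_cancel_right[of ?n 2 ?n] by (simp only: power2_eq_square)
    then have "(2 / ?n - 4 * (fst p)\<^sup>2 / ?n\<^sup>2) + (2 / ?n - 4 * (snd p)\<^sup>2 / ?n\<^sup>2) =
      (4 * ?n - 4 * ((fst p)\<^sup>2 + (snd p)\<^sup>2)) / ?n\<^sup>2"
      by (simp add: add_divide_distrib diff_divide_distrib)
    then show ?thesis by (simp add: norm_prod_sq)
  qed
  have 1: "has_second_derivative (\<lambda>t. ln (t\<^sup>2 + ((snd p)\<^sup>2 + c))) (2 / ?n - 4 * (fst p)\<^sup>2 / ?n\<^sup>2) (fst p)"
    using has_second_derivative_ln[of "fst p" "(snd p)\<^sup>2 + c"] assms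
    by (simp add: norm_prod_sq ac_simps)
  have 2: "has_second_derivative (\<lambda>t. ln (t\<^sup>2 + ((fst p)\<^sup>2 + c))) (2 / ?n - 4 * (snd p)\<^sup>2 / ?n\<^sup>2) (snd p)"
    using has_second_derivative_ln[of "snd p" "(fst p)\<^sup>2 + c"] assms
    by (simp add: norm_prod_sq ac_simps)
  show ?thesis using 1 2
    by (intro has_laplacianI[OF _ _ eq]) (auto simp: norm_prod_sq ac_simps)
qed

lemma has_second_derivative_inverse:
  assumes "(t - m)\<^sup>2 + c > (0::real)" 
  shows "has_second_derivative (\<lambda>t. inverse ((t - m)\<^sup>2 + c))
    (8 * (t - m)\<^sup>2 / ((t - m)\<^sup>2 + c) ^ 3 - 2 / ((t - m)\<^sup>2 + c)\<^sup>2) t"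
proof (rule has_second_derivativeI)
  show "open {t. (t - m)\<^sup>2 + c > 0}" by (intro open_Collect_less continuous_intros)
  show "((\<lambda>t. inverse ((t - m)\<^sup>2 + c)) has_real_derivative - 2 * (x - m) / ((x - m)\<^sup>2 + c)\<^sup>2) (at x)"
    if "x \<in> {t. (t - m)\<^sup>2 + c > 0}" for x
    using that by (auto intro!: derivative_eq_intros simp: field_simps power2_eq_square)
  let ?X = "t - m" and ?Q = "(t - m)\<^sup>2 + c"
  have "((\<lambda>x. - 2 * (x - m) / ((x - m)\<^sup>2 + c)\<^sup>2) has_real_derivative
      (- 2 * ?Q\<^sup>2 - (- 2 * ?X) * (2 * ?Q * (2 * ?X))) / (?Q\<^sup>2 * ?Q\<^sup>2)) (at t)"
    using assms by (intro DERIV_divide) (auto intro!: derivative_eq_intros)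
  also have "(- 2 * Q\<^sup>2 - (- 2 * X) * (2 * Q * (2 * X))) / (Q\<^sup>2 * Q\<^sup>2) = 8 * X\<^sup>2 / Q ^ 3 - 2 / Q\<^sup>2"
    if "Q > 0" for X Q :: real
    using that by (simp add: divide_simps) (simp add: eval_nat_numeral algebra_simps)
  note this[OF assms, of ?X]
  finally show "((\<lambda>x. - 2 * (x - m) / ((x - m)\<^sup>2 + c)\<^sup>2) has_real_derivative
      8 * (t - m)\<^sup>2 / ((t - m)\<^sup>2 + c) ^ 3 - 2 / ((t - m)\<^sup>2 + c)\<^sup>2) (at t)" .
qed (use assms in auto)

text \<open>
  A radial function that is strictly subharmonic away from its centre, hence a barrier of Hopf type.
\<close>
lemma has_laplacian_inverse_norm_sq:
  assumes "p \<noteq> y"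
  shows "has_laplacian (\<lambda>q. inverse ((norm (q - y))\<^sup>2)) (4 / (norm (p - y)) ^ 4) p"
proof -
  let ?n = "(norm (p - y))\<^sup>2"
  have pos: "?n > 0" using assms by simp
  have 1: "has_second_derivative (\<lambda>t. inverse ((t - fst y)\<^sup>2 + (snd p - snd y)\<^sup>2))
     (8 * (fst p - fst y)\<^sup>2 / ?n ^ 3 - 2 / ?n\<^sup>2) (fst p)"
    using has_second_derivative_inverse[of "fst p" "fst y" "(snd p - snd y)\<^sup>2"] pos
    by (simp add: norm_prod_sq)
  have 2: "has_second_derivative (\<lambda>t. inverse ((t - snd y)\<^sup>2 + (fst p - fst y)\<^sup>2))
     (8 * (snd p - snd y)\<^sup>2 / ?n ^ 3 - 2 / ?n\<^sup>2) (snd p)"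
    using has_second_derivative_inverse[of "snd p" "snd y" "(fst p - fst y)\<^sup>2"] pos
    by (simp add: norm_prod_sq add.commute)
  have "(8 * (fst p - fst y)\<^sup>2 / ?n ^ 3 - 2 / ?n\<^sup>2) + (8 * (snd p - snd y)\<^sup>2 / ?n ^ 3 - 2 / ?n\<^sup>2)
    = 8 * ?n / ?n ^ 3 - 4 / ?n\<^sup>2"
    by (simp add: norm_prod_sq add_divide_distrib distrib_left)
  also have "\<dots> = 4 / ?n\<^sup>2"
    using pos by (simp add: power3_eq_cube power2_eq_square)
  also have "?n\<^sup>2 = norm (p - y) ^ 4" by (simp flip: power_mult)
  finally have 3: "4 / norm (p - y) ^ 4 = (8 * (fst p - fst y)\<^sup>2 / ?n ^ 3 - 2 / ?n\<^sup>2) + (8 * (snd p - snd y)\<^sup>2 / ?n ^ 3 - 2 / ?n\<^sup>2)"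
    by simp
  show ?thesis using 1 2
    by (intro has_laplacianI[OF _ _ 3]) (auto simp: norm_prod_sq ac_simps)
qed

lemma has_second_derivative_inverse_sqrt:
  assumes "c > (0::real)"
  shows "has_second_derivative (\<lambda>t. 1 / sqrt (t\<^sup>2 + c))
    (3 * t\<^sup>2 / sqrt (t\<^sup>2 + c) ^ 5 - 1 / sqrt (t\<^sup>2 + c) ^ 3) t"
proof (rule has_second_derivativeI[of UNIV])
  have pos: "x\<^sup>2 + c > 0" for x using assms by (simp add: add_nonneg_pos)
  have dS: "((\<lambda>x. sqrt (x\<^sup>2 + c)) has_real_derivative x / sqrt (x\<^sup>2 + c)) (at x)" for x
    using pos[of x] by (auto intro!: derivative_eq_intros simp: field_simps)
  have dS3: "((\<lambda>x. sqrt (x\<^sup>2 + c) ^ 3) has_real_derivative 3 * sqrt (x\<^sup>2 + c) * x) (at x)" for x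
  proof -
    have "((\<lambda>x. sqrt (x\<^sup>2 + c) ^ 3) has_real_derivative
        real 3 * (x / sqrt (x\<^sup>2 + c) * sqrt (x\<^sup>2 + c) ^ (3 - Suc 0))) (at x)"
      by (rule DERIV_power[OF dS])
    also have "real 3 * (x / sqrt (x\<^sup>2 + c) * sqrt (x\<^sup>2 + c) ^ (3 - Suc 0)) = 3 * sqrt (x\<^sup>2 + c) * x"
      using pos[of x] by (simp add: eval_nat_numeral del: real_sqrt_mult_self)
    finally show ?thesis .
  qed
  show "((\<lambda>t. 1 / sqrt (t\<^sup>2 + c)) has_real_derivative - x / sqrt (x\<^sup>2 + c) ^ 3) (at x)" for x
    using DERIV_divide[OF DERIV_const dS, of x 1] pos[of x]
    by (simp add: eval_nat_numeral)
  define S where "S = sqrt (t\<^sup>2 + c)"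
  have S: "S > 0" using pos[of t] by (simp add: S_def)
  have "((\<lambda>x. - x / sqrt (x\<^sup>2 + c) ^ 3) has_real_derivative
      ((- 1) * S ^ 3 - (- t) * (3 * S * t)) / (S ^ 3 * S ^ 3)) (at t)"
    unfolding S_def using pos[of t] by (intro DERIV_divide dS3) (auto intro!: derivative_eq_intros)
  also have "((- 1) * S ^ 3 - (- t) * (3 * S * t)) / (S ^ 3 * S ^ 3) = 3 * t\<^sup>2 / S ^ 5 - 1 / S ^ 3"
    using S by (simp add: divide_simps) (simp add: eval_nat_numeral algebra_simps)
  finally show "((\<lambda>x. - x / sqrt (x\<^sup>2 + c) ^ 3) has_real_derivative
      3 * t\<^sup>2 / sqrt (t\<^sup>2 + c) ^ 5 - 1 / sqrt (t\<^sup>2 + c) ^ 3) (at t)"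
    by (simp add: S_def)
qed auto

text \<open>
  Minus this function is bounded and superharmonic for \<open>\<bar>p\<bar>\<^sup>2 > 2\<close>, with Laplacian of order \<open>- \<bar>p\<bar> ^ (- 3)\<close>
  at infinity. This beats the order \<open>\<bar>p\<bar> ^ (- 4)\<close> of the zeroth order coefficient that the moving plane
  method produces.
\<close>
lemma has_laplacian_inverse_sqrt:
  "has_laplacian (\<lambda>q. 1 / sqrt (1 + (norm q)\<^sup>2)) (((norm p)\<^sup>2 - 2) / sqrt (1 + (norm p)\<^sup>2) ^ 5) p"
proof -
  define S where "S = sqrt (1 + (norm p)\<^sup>2)"
  have S: "S > 0" "S\<^sup>2 = 1 + (norm p)\<^sup>2" by (auto simp: S_def add_pos_nonneg)
  have "2 / S ^ 3 = 2 * S\<^sup>2 / S ^ 5" using S(1) by (simp add: eval_nat_numeral)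
  moreover have "(norm p)\<^sup>2 - 2 = 3 * ((fst p)\<^sup>2 + (snd p)\<^sup>2) - 2 * S\<^sup>2"
    using S(2) by (simp add: norm_prod_sq)
  ultimately have eq: "((norm p)\<^sup>2 - 2) / S ^ 5 =
      (3 * (fst p)\<^sup>2 / S ^ 5 - 1 / S ^ 3) + (3 * (snd p)\<^sup>2 / S ^ 5 - 1 / S ^ 3)"
    by (simp add: add_divide_distrib diff_divide_distrib distrib_left)
  have S1: "S = sqrt ((fst p)\<^sup>2 + (1 + (snd p)\<^sup>2))" and S2: "S = sqrt ((snd p)\<^sup>2 + (1 + (fst p)\<^sup>2))"
    by (simp_all add: S_def norm_prod_sq ac_simps)
  have 1: "has_second_derivative (\<lambda>t. 1 / sqrt (t\<^sup>2 + (1 + (snd p)\<^sup>2)))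
      (3 * (fst p)\<^sup>2 / S ^ 5 - 1 / S ^ 3) (fst p)"
    unfolding S1 by (rule has_second_derivative_inverse_sqrt) (simp add: add_pos_nonneg)
  have 2: "has_second_derivative (\<lambda>t. 1 / sqrt (t\<^sup>2 + (1 + (fst p)\<^sup>2)))
      (3 * (snd p)\<^sup>2 / S ^ 5 - 1 / S ^ 3) (snd p)"
    unfolding S2 by (rule has_second_derivative_inverse_sqrt) (simp add: add_pos_nonneg)
  show ?thesis unfolding S_def[symmetric]
    using 1 2 by (intro has_laplacianI[OF _ _ eq]) (auto simp: norm_prod_sq ac_simps)
qed

lemma has_laplacian_exp_fst:
  "has_laplacian (\<lambda>q. exp (N * (fst q - c))) (N\<^sup>2 * exp (N * (fst p - c))) p"
proof (rule has_laplacianI)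
  have "has_second_derivative (\<lambda>t. exp (N * (t - c))) (N\<^sup>2 * exp (N * (fst p - c))) (fst p)"
    by (rule has_second_derivativeI[of UNIV _ _ "\<lambda>t. N * exp (N * (t - c))"])
       (auto intro!: derivative_eq_intros simp: power2_eq_square)
  then show "has_second_derivative (\<lambda>t. exp (N * (fst (t, snd p) - c)))
      (N\<^sup>2 * exp (N * (fst p - c))) (fst p)" by simp
  show "has_second_derivative (\<lambda>t. exp (N * (fst (fst p, t) - c))) 0 (snd p)"
    by (rule has_second_derivativeI[of UNIV _ _ "\<lambda>_. 0"]) auto
qed simp

section \<open>Minimum principles for superharmonic functions\<close>

definition superharmonic_on :: "(real \<times> real) set \<Rightarrow> (real \<times> real \<Rightarrow> real) \<Rightarrow> bool"
  where "superharmonic_on \<Omega> w \<longleftrightarrow> (\<forall>p\<in>\<Omega>. \<exists>L\<le>0. has_laplacian w L p)"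

lemma superharmonic_on_subset: "superharmonic_on T w \<Longrightarrow> S \<subseteq> T \<Longrightarrow> superharmonic_on S w"
  unfolding superharmonic_on_def by blast

text \<open>
  The centre is removable for the minimum principle because every positive multiple of \<open>ln \<bar>p\<bar>\<close>
  bounds \<open>w\<close> from below there: after adding a small multiple of \<open>- ln \<bar>p\<bar>\<close> the function tends to infinity at
  the centre, so its minimum lies on the outer circle. This is how the growth condition at the
  north pole enters the whole proof.
\<close>
lemma superharmonic_min_punctured_disc:
  assumes R: "R > 0"
    and cont: "continuous_on (cball 0 R - {0}) w"
    and sup: "superharmonic_on (ball 0 R - {0}) w"
    and bdry: "\<And>p. norm p = R \<Longrightarrow> m \<le> w p"
    and sing: "\<And>\<epsilon>. \<epsilon> > 0 \<Longrightarrow> \<exists>\<delta>>0. \<forall>p. 0 < norm p \<and> norm p < \<delta> \<longrightarrow> \<epsilon> * ln (norm p) \<le> w p"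
    and q: "0 < norm q" "norm q \<le> R"
  shows "m \<le> w q"
proof -
  (* b vanishes on the circle of radius R and is positive inside; the quadratic part makes it
     strictly superharmonic *)
  define b where "b = (\<lambda>p::real \<times> real. (ln (R\<^sup>2) - ln ((norm p)\<^sup>2)) + (R\<^sup>2 - (norm p)\<^sup>2))"
  have key: "w q - m + \<epsilon> * b q \<ge> 0" if eps: "\<epsilon> > 0" for \<epsilon>
  proof (rule ccontr)
    define z where "z = (\<lambda>p. w p - m + \<epsilon> * b p)"
    assume "\<not> w q - m + \<epsilon> * b q \<ge> 0"
    then have zq: "z q < 0" by (simp add: z_def)
    obtain \<delta>0 where \<delta>0: "\<delta>0 > 0" "\<And>p. 0 < norm p \<Longrightarrow> norm p < \<delta>0 \<Longrightarrow> \<epsilon> * ln (norm p) \<le> w p"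
      using sing[OF eps] by blast
    define \<delta> where "\<delta> = Min {\<delta>0 / 2, R, exp ((- m + 2 * \<epsilon> * ln R) / \<epsilon>)}"
    have \<delta>: "\<delta> > 0" "\<delta> < \<delta>0" "\<delta> \<le> R" "\<delta> \<le> exp ((- m + 2 * \<epsilon> * ln R) / \<epsilon>)"
      using \<delta>0(1) R by (auto simp: \<delta>_def min_def)
    have near: "z p \<ge> 0" if p: "0 < norm p" "norm p \<le> \<delta>" for p
    proof -
      have "ln (norm p) \<le> (- m + 2 * \<epsilon> * ln R) / \<epsilon>"
        using p \<delta>(4) by (subst ln_exp[symmetric], subst ln_le_cancel_iff) auto
      then have 1: "\<epsilon> * ln (norm p) \<le> - m + 2 * \<epsilon> * ln R"
        using eps by (simp add: field_simps)
      have "(norm p)\<^sup>2 \<le> R\<^sup>2" using p \<delta>(3) by (intro power_mono) auto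
      then have "\<epsilon> * (R\<^sup>2 - (norm p)\<^sup>2) \<ge> 0" using eps by simp
      moreover have "\<epsilon> * ln (norm p) \<le> w p" using \<delta>0(2)[of p] p \<delta>(2) by simp
      moreover have "ln (R\<^sup>2) = 2 * ln R" "ln ((norm p)\<^sup>2) = 2 * ln (norm p)"
        using R p by (simp_all add: ln_realpow)
      ultimately show ?thesis using 1
        by (simp add: z_def b_def algebra_simps)
    qed
    define A where "A = cball 0 R - ball (0::real \<times> real) \<delta>"
    have A0: "0 \<notin> A" using \<delta>(1) by (simp add: A_def)
    have "compact A" unfolding A_def by (intro compact_diff) auto
    moreover have qA: "q \<in> A" using q near[of q] zq by (force simp: A_def)
    moreover have "continuous_on A z"
      unfolding z_def b_def using A0
      by (intro continuous_intros continuous_on_subset[OF cont]) (auto simp: A_def)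
    ultimately obtain p where p: "p \<in> A" "\<And>y. y \<in> A \<Longrightarrow> z p \<le> z y"
      using continuous_attains_inf[of A z] by blast
    have zp: "z p < 0" using p(2)[OF qA] zq by simp
    have pnz: "p \<noteq> 0" using p(1) A0 by auto
    have p1: "norm p > \<delta>" using near[of p] zp p(1) pnz by (cases "norm p \<le> \<delta>") auto
    have p2: "norm p < R"
    proof (rule ccontr)
      assume "\<not> norm p < R"
      then have "norm p = R" using p(1) by (auto simp: A_def)
      then have "z p \<ge> 0" using bdry[of p] by (simp add: z_def b_def)
      then show False using zp by simp
    qed
    obtain L where L: "L \<le> 0" "has_laplacian w L p"
      using bspec[OF sup[unfolded superharmonic_on_def], of p] p2 pnz by auto
    have "has_laplacian z (L - 0 + \<epsilon> * ((0 - 0) + (0 - 4))) p"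
      unfolding z_def b_def
      using has_laplacian_ln[of p 0] pnz
      by (intro has_laplacian_add has_laplacian_diff has_laplacian_cmult has_laplacian_const
          has_laplacian_norm_sq L(2)) auto
    moreover have "open (ball 0 R - cball (0::real \<times> real) \<delta>)" by auto
    moreover have "p \<in> ball 0 R - cball 0 \<delta>" using p1 p2 by simp
    ultimately have "L - 0 + \<epsilon> * ((0 - 0) + (0 - 4)) \<ge> 0"
      by (rule has_laplacian_local_min) (auto simp: A_def intro!: p(2))
    then show False using L(1) eps by simp
  qed
  have "((\<lambda>\<epsilon>. w q - m + \<epsilon> * b q) \<longlongrightarrow> w q - m + 0 * b q) (at_right 0)"
    by (intro tendsto_intros)
  then have "0 \<le> w q - m + 0 * b q"
    by (rule tendsto_lowerbound) (auto simp: eventually_at_right_less key intro: eventually_at_right_less eventually_mono[OF eventually_at_right_less])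
  then show ?thesis by simp
qed

text \<open>
  If \<open>w\<close> vanishes at one point but not nearby, take the largest disc around a point of positivity
  that contains no zero of \<open>w\<close>. At a zero on its boundary, subtracting a small multiple of the barrier
  \<open>1 / \<bar>p - c\<bar>\<^sup>2\<close> gives a strictly superharmonic function with an interior minimum. So the zero set
  is open as well as closed.
\<close>
lemma strong_minimum_principle:
  assumes op: "open \<Omega>" and conn: "connected \<Omega>" and cont: "continuous_on \<Omega> w"
    and sup: "superharmonic_on \<Omega> w" and nonneg: "\<And>p. p \<in> \<Omega> \<Longrightarrow> w p \<ge> 0"
    and p0: "p0 \<in> \<Omega>" "w p0 = 0" and q: "q \<in> \<Omega>"
  shows "w q = 0"
proof -
  have loc: "w y = 0" if x0: "x0 \<in> \<Omega>" "w x0 = 0" and r: "cball x0 (2 * r) \<subseteq> \<Omega>"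
    and y: "dist y x0 < r" for x0 y r
  proof (rule ccontr)
    assume "w y \<noteq> 0"
    have cbr: "cball y r \<subseteq> \<Omega>"
    proof
      fix z assume "z \<in> cball y r"
      then have "dist x0 z \<le> 2 * r" using y dist_triangle[of x0 z y] by (simp add: dist_commute)
      then show "z \<in> \<Omega>" using r by auto
    qed
    define Z where "Z = {z \<in> cball y r. w z = 0}"
    have "closed Z" unfolding Z_def
      by (intro continuous_closed_preimage_constant continuous_on_subset[OF cont cbr]) auto
    moreover have "x0 \<in> Z" using x0 y by (auto simp: Z_def)
    ultimately obtain x1 where x1: "x1 \<in> Z" "\<And>z. z \<in> Z \<Longrightarrow> dist y x1 \<le> dist y z"
      using distance_attains_inf[of Z y] by blast
    define \<rho> where "\<rho> = dist y x1 / 2"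
    have "w x1 = 0" using x1 by (simp add: Z_def)
    then have \<rho>: "\<rho> > 0" using \<open>w y \<noteq> 0\<close> by (auto simp: \<rho>_def)
    have \<rho>r: "2 * \<rho> < r" using x1(2)[OF \<open>x0 \<in> Z\<close>] y by (simp add: \<rho>_def dist_commute)
    (* the disc of half the radius that touches the big disc at x1 from inside: its closure meets
       the zero set only at x1 *)
    define c where "c = (1 / 2) *\<^sub>R (y + x1)"
    have cx: "dist c x1 = \<rho>"  "dist y c = \<rho>"
    proof -
      have "c - x1 = (1 / 2) *\<^sub>R (y - x1)" "y - c = (1 / 2) *\<^sub>R (y - x1)"
        by (auto simp: c_def algebra_simps simp flip: scaleR_add_left)
      then show "dist c x1 = \<rho>" "dist y c = \<rho>" by (simp_all add: dist_norm \<rho>_def)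
    qed
    have wpos: "w z > 0" if z: "dist c z \<le> \<rho>" "z \<noteq> x1" for z
    proof -
      have "dist y z < 2 * \<rho>"
      proof (rule ccontr)
        assume "\<not> dist y z < 2 * \<rho>"
        then have eq: "dist y z = dist y c + dist c z" "dist c z = \<rho>"
          using dist_triangle[of y z c] cx z by auto
        have "norm ((y - c) + (c - z)) = norm (y - c) + norm (c - z)"
          using eq by (simp add: dist_norm)
        then have "norm (y - c) *\<^sub>R (c - z) = norm (c - z) *\<^sub>R (y - c)"
          by (rule norm_triangle_eq[THEN iffD1])
        then have "c - z = y - c" using eq cx \<rho> by (simp add: dist_norm)
        then have "z = 2 *\<^sub>R c - y" by (simp add: algebra_simps scaleR_2)
        then have "z = x1" by (simp add: c_def)
        then show False using z by simp
      qed
      then have "z \<notin> Z" "z \<in> cball y r" using x1(2)[of z] \<rho>r by (force simp: \<rho>_def)+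
      then show "w z > 0" using nonneg[of z] cbr by (force simp: Z_def)
    qed
    have "x1 \<in> \<Omega>" using x1(1) cbr by (auto simp: Z_def)
    then obtain s0 where s0: "s0 > 0" "cball x1 s0 \<subseteq> \<Omega>"
      using op open_contains_cball by blast
    define s where "s = min s0 (\<rho> / 2)"
    have s: "s > 0" "cball x1 s \<subseteq> \<Omega>" "s < \<rho>" using s0 \<rho> by (auto simp: s_def)
    have cs: "c \<notin> cball x1 s" using cx s by (simp add: dist_commute)
    define h where "h = (\<lambda>p. inverse ((norm (p - c))\<^sup>2) - inverse (\<rho>\<^sup>2))"
    have conth: "continuous_on (cball x1 s) h" unfolding h_def using cs
      by (intro continuous_intros) auto
    have contw: "continuous_on (cball x1 s) w" by (rule continuous_on_subset[OF cont s(2)])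
    define E where "E = sphere x1 s \<inter> cball c \<rho>"
    have "\<exists>\<epsilon>>0. \<forall>z\<in>E. \<epsilon> * h z \<le> w z"
    proof (cases "E = {}")
      case True then show ?thesis by (auto intro: exI[of _ 1])
    next
      case False
      have E: "compact E" "E \<subseteq> cball x1 s" by (auto simp: E_def)
      obtain z1 where z1: "z1 \<in> E" "\<And>z. z \<in> E \<Longrightarrow> w z1 \<le> w z"
        using continuous_attains_inf[OF E(1) False continuous_on_subset[OF contw E(2)]] by blast
      obtain z2 where z2: "z2 \<in> E" "\<And>z. z \<in> E \<Longrightarrow> h z \<le> h z2"
        using continuous_attains_sup[OF E(1) False continuous_on_subset[OF conth E(2)]] by blast
      have w1: "w z1 > 0" using z1(1) s(1) by (intro wpos) (auto simp: E_def)
      define \<epsilon> where "\<epsilon> = w z1 / (1 + \<bar>h z2\<bar>)"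
      have "\<epsilon> > 0" using w1 by (simp add: \<epsilon>_def add_pos_nonneg)
      moreover have "\<epsilon> * h z \<le> w z" if "z \<in> E" for z
      proof -
        have "\<epsilon> * h z \<le> \<epsilon> * (1 + \<bar>h z2\<bar>)"
          using z2(2)[OF that] \<open>\<epsilon> > 0\<close> by (intro mult_left_mono) auto
        also have "\<dots> = w z1" by (simp add: \<epsilon>_def add_pos_nonneg[THEN less_imp_neq, symmetric])
        finally show ?thesis using z1(2)[OF that] by simp
      qed
      ultimately show ?thesis by blast
    qed
    then obtain \<epsilon> where \<epsilon>: "\<epsilon> > 0" "\<And>z. z \<in> E \<Longrightarrow> \<epsilon> * h z \<le> w z" by blast
    define z where "z = (\<lambda>p. w p - \<epsilon> * h p)"
    have "continuous_on (cball x1 s) z" unfolding z_def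
      by (intro continuous_intros contw conth)
    then obtain p where p: "p \<in> cball x1 s" "\<And>q. q \<in> cball x1 s \<Longrightarrow> z p \<le> z q"
      using continuous_attains_inf[of "cball x1 s" z] s(1) by auto
    have zx1: "z x1 = 0" using \<open>w x1 = 0\<close> cx by (simp add: z_def h_def dist_norm norm_minus_commute)
    have bd: "z q \<ge> 0" if "q \<in> sphere x1 s" for q
    proof (cases "q \<in> cball c \<rho>")
      case True
      then show ?thesis using \<epsilon>(2)[of q] that by (simp add: E_def z_def)
    next
      case False
      then have "\<rho>\<^sup>2 \<le> (norm (q - c))\<^sup>2"
        using \<rho> by (intro power_mono) (auto simp: dist_norm norm_minus_commute)
      then have "h q \<le> 0" using \<rho> by (simp add: h_def le_imp_inverse_le)
      then have "\<epsilon> * h q \<le> 0" using \<epsilon>(1) by (simp add: mult_nonneg_nonpos)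
      moreover have "q \<in> \<Omega>" using that s(2) sphere_cball by blast
      then have "w q \<ge> 0" by (rule nonneg)
      ultimately show ?thesis by (simp add: z_def)
    qed
    have "\<exists>p'\<in>ball x1 s. \<forall>q\<in>cball x1 s. z p' \<le> z q"
    proof (cases "p \<in> ball x1 s")
      case False
      then have "p \<in> sphere x1 s" using p(1) by auto
      then have "z p \<ge> 0" by (rule bd)
      then have "\<forall>q\<in>cball x1 s. z x1 \<le> z q" using p(2) zx1 by force
      then show ?thesis using s(1) by (intro bexI[of _ x1]) auto
    qed (use p(2) in blast)
    then obtain p' where p': "p' \<in> ball x1 s" "\<And>q. q \<in> cball x1 s \<Longrightarrow> z p' \<le> z q" by blast
    have "p' \<in> cball x1 s" using p'(1) by auto
    then have pc: "p' \<noteq> c" "p' \<in> \<Omega>" using cs s(2) by auto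
    obtain L where L: "L \<le> 0" "has_laplacian w L p'"
      using bspec[OF sup[unfolded superharmonic_on_def], of p'] pc by auto
    have "has_laplacian z (L - \<epsilon> * (4 / norm (p' - c) ^ 4 - 0)) p'"
      unfolding z_def h_def using pc(1)
      by (intro has_laplacian_diff has_laplacian_cmult has_laplacian_const
          has_laplacian_inverse_norm_sq L(2))
    then have "L - \<epsilon> * (4 / norm (p' - c) ^ 4 - 0) \<ge> 0"
      using open_ball p'(1) by (rule has_laplacian_local_min) (auto intro: p'(2))
    moreover have "\<epsilon> * (4 / norm (p' - c) ^ 4 - 0) > 0" using \<epsilon>(1) pc(1) by simp
    ultimately show False using L(1) by linarith
  qed
  define Z where "Z = {p \<in> \<Omega>. w p = 0}"
  have "open Z" unfolding open_contains_ball
  proof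
    fix x assume x: "x \<in> Z"
    then obtain e where e: "e > 0" "cball x e \<subseteq> \<Omega>"
      using op open_contains_cball unfolding Z_def by blast
    have "ball x (e / 2) \<subseteq> Z"
    proof
      fix y assume "y \<in> ball x (e / 2)"
      then have "dist y x < e / 2" by (simp add: dist_commute)
      moreover from this have "y \<in> \<Omega>" using e by (auto simp: dist_commute)
      ultimately show "y \<in> Z" using loc[of x "e / 2" y] x e(2) by (simp add: Z_def)
    qed
    then show "\<exists>e>0. ball x e \<subseteq> Z" using e(1) by (intro exI[of _ "e / 2"]) auto
  qed
  moreover have "closedin (top_of_set \<Omega>) Z" unfolding Z_def
    by (rule continuous_closedin_preimage_constant[OF cont])
  moreover have "Z \<subseteq> \<Omega>" by (auto simp: Z_def)
  ultimately have "Z = {} \<or> Z = \<Omega>"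
    using conn unfolding connected_clopen by (metis openin_open_eq op)
  then show ?thesis using p0 q unfolding Z_def by blast
qed

section \<open>The moving plane method\<close>

definition reflection :: "real \<Rightarrow> real \<times> real \<Rightarrow> real \<times> real"
  where "reflection \<mu> p = (2 * \<mu> - fst p, snd p)"

lemma fst_le_norm: "fst p \<le> norm p" for p :: "real \<times> real"
  using norm_fst_le[of "fst p" "snd p"] by simp

text \<open>
  The stereographic picture of the problem: the singular point of the equation sits at the origin
  and the south pole at infinity. The assumption \<open>infinity\<close> says that the metric \<open>exp (2 u) |dx|\<^sup>2\<close>
  extends continuously over the point at infinity, \<open>origin\<close> is the growth condition at the pole, and
  \<open>nondegenerate\<close> excludes the case in which the coefficients admit a reflection symmetry off the centre.
\<close>
locale moving_plane =
  fixes u k F :: "real \<times> real \<Rightarrow> real" and l :: real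
  assumes laplacian: "p \<noteq> 0 \<Longrightarrow> has_laplacian u (- (k p * exp (2 * u p) + F p)) p"
    and cont: "continuous_on (- {0}) u"
    and k_nonneg: "p \<noteq> 0 \<Longrightarrow> 0 \<le> k p"
    and F_nonneg: "p \<noteq> 0 \<Longrightarrow> 0 \<le> F p"
    and k_antimono: "p \<noteq> 0 \<Longrightarrow> norm p \<le> norm q \<Longrightarrow> k q \<le> k p"
    and F_antimono: "p \<noteq> 0 \<Longrightarrow> norm p \<le> norm q \<Longrightarrow> F q \<le> F p"
    and decay: "\<rho> > 0 \<Longrightarrow> \<exists>C. \<forall>p. \<rho> \<le> norm p \<longrightarrow> k p * exp (2 * u p) \<le> C / (1 + (norm p)\<^sup>2)\<^sup>2"
    and infinity: "((\<lambda>p. u p + ln (1 + (norm p)\<^sup>2)) \<longlongrightarrow> l) at_infinity"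
    and origin: "\<epsilon> > 0 \<Longrightarrow> \<exists>\<delta>>0. \<forall>p. 0 < norm p \<and> norm p < \<delta> \<longrightarrow> \<epsilon> * ln (norm p) \<le> u p"
    and nondegenerate: "\<mu> > 0 \<Longrightarrow>
      \<exists>p. p \<noteq> 0 \<and> fst p < \<mu> \<and> (k (reflection \<mu> p) \<noteq> k p \<or> F (reflection \<mu> p) \<noteq> F p)"
begin

text \<open>
  The moving plane method shows that \<open>u\<close> is at least its reflection in every line \<open>x = \<mu>\<close> with \<open>\<mu> > 0\<close>,
  on the side of that line which contains the origin.
\<close>
definition gap :: "real \<Rightarrow> real \<times> real \<Rightarrow> real"
  where "gap \<mu> p = u p - u (reflection \<mu> p)"

definition dominated :: "real \<Rightarrow> bool"
  where "dominated \<mu> \<longleftrightarrow> (\<forall>p. p \<noteq> 0 \<longrightarrow> fst p < \<mu> \<longrightarrow> 0 \<le> gap \<mu> p)"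

lemma dominatedD: "dominated \<mu> \<Longrightarrow> p \<noteq> 0 \<Longrightarrow> fst p < \<mu> \<Longrightarrow> 0 \<le> gap \<mu> p"
  unfolding dominated_def by blast

lemma reflection_norm:
  assumes "\<mu> > 0" "fst p < \<mu>"
  shows "norm p \<le> norm (reflection \<mu> p)" "reflection \<mu> p \<noteq> 0" "\<mu> < norm (reflection \<mu> p)"
proof -
  have "(norm (reflection \<mu> p))\<^sup>2 - (norm p)\<^sup>2 = 4 * \<mu> * (\<mu> - fst p)"
    unfolding norm_prod_sq by (simp add: reflection_def power2_eq_square algebra_simps)
  also have "\<dots> \<ge> 0" using assms by simp
  finally have "(norm p)\<^sup>2 \<le> (norm (reflection \<mu> p))\<^sup>2" by simp
  then show "norm p \<le> norm (reflection \<mu> p)" by (rule power2_le_imp_le) simp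
  have "\<mu> < fst (reflection \<mu> p)" using assms by (simp add: reflection_def)
  then show "\<mu> < norm (reflection \<mu> p)" using fst_le_norm by (rule less_le_trans)
  then show "reflection \<mu> p \<noteq> 0" using assms by auto
qed

lemma isCont_u: "p \<noteq> 0 \<Longrightarrow> isCont u p"
  using cont by (simp add: continuous_on_eq_continuous_at open_delete Compl_eq_Diff_UNIV)

lemma superharmonic_u: "superharmonic_on (- {0}) u"
  unfolding superharmonic_on_def
proof (intro ballI exI conjI)
  fix p :: "real \<times> real" assume "p \<in> - {0}"
  then have p: "p \<noteq> 0" by simp
  show "has_laplacian u (- (k p * exp (2 * u p) + F p)) p" by (rule laplacian[OF p])
  show "- (k p * exp (2 * u p) + F p) \<le> 0"
    using mult_nonneg_nonneg[OF k_nonneg[OF p] exp_ge_zero[of "2 * u p"]] F_nonneg[OF p] by linarith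
qed

lemma gap_laplacian:
  assumes "\<mu> > 0" "p \<noteq> 0" "fst p < \<mu>"
  defines "q \<equiv> reflection \<mu> p"
  shows "has_laplacian (gap \<mu>)
    (- (k p * exp (2 * u p) + F p) + (k q * exp (2 * u q) + F q)) p"
proof -
  have q: "q \<noteq> 0" using reflection_norm[OF assms(1,3)] by (simp add: q_def)
  have "has_laplacian (\<lambda>p. u (2 * \<mu> - fst p, snd p)) (- (k q * exp (2 * u q) + F q)) p"
    using laplacian[OF q] by (intro has_laplacian_reflect) (simp add: q_def reflection_def)
  from has_laplacian_diff[OF laplacian[OF assms(2)] this] show ?thesis
    by (simp add: gap_def[abs_def] reflection_def algebra_simps)
qed

text \<open>
  Reflection moves points away from the origin, where both coefficients are smaller; what remains
  is the monotone exponential nonlinearity. In particular the gap is superharmonic wherever it is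
  nonnegative.
\<close>
lemma gap_laplacian_le:
  assumes "\<mu> > 0" "p \<noteq> 0" "fst p < \<mu>"
  defines "q \<equiv> reflection \<mu> p"
  shows "- (k p * exp (2 * u p) + F p) + (k q * exp (2 * u q) + F q) \<le>
    k q * (exp (2 * u q) - exp (2 * u p))"
proof -
  have n: "norm p \<le> norm q" using reflection_norm[OF assms(1,3)] by (simp add: q_def)
  have "k q * exp (2 * u p) \<le> k p * exp (2 * u p)"
    by (intro mult_right_mono k_antimono[OF assms(2) n]) auto
  with F_antimono[OF assms(2) n] show ?thesis unfolding right_diff_distrib by linarith
qed

lemma continuous_on_gap: "\<mu> > 0 \<Longrightarrow> continuous_on ({p. fst p \<le> \<mu>} - {0}) (gap \<mu>)"
  unfolding gap_def reflection_def
  by (intro continuous_intros continuous_on_compose2[OF cont])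
     (auto simp: zero_prod_def)

lemma superharmonic_gap:
  assumes "\<mu> > 0" "dominated \<mu>"
  shows "superharmonic_on ({p. fst p < \<mu>} - {0}) (gap \<mu>)"
  unfolding superharmonic_on_def
proof (intro ballI exI conjI)
  fix p :: "real \<times> real" assume "p \<in> {p. fst p < \<mu>} - {0}"
  then have p: "p \<noteq> 0" "fst p < \<mu>" by auto
  show "has_laplacian (gap \<mu>) (- (k p * exp (2 * u p) + F p) +
    (k (reflection \<mu> p) * exp (2 * u (reflection \<mu> p)) + F (reflection \<mu> p))) p"
    by (rule gap_laplacian[OF assms(1) p])
  have "k (reflection \<mu> p) * (exp (2 * u (reflection \<mu> p)) - exp (2 * u p)) \<le> 0"
    using dominatedD[OF assms(2) p] k_nonneg[OF reflection_norm(2)[OF assms(1) p(2)]]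
    by (intro mult_nonneg_nonpos) (auto simp: gap_def)
  with gap_laplacian_le[OF assms(1) p]
  show "- (k p * exp (2 * u p) + F p) +
    (k (reflection \<mu> p) * exp (2 * u (reflection \<mu> p)) + F (reflection \<mu> p)) \<le> 0" by linarith
qed

lemma u_at_infinity:
  assumes "\<epsilon> > 0"
  shows "\<exists>R. \<forall>p. R \<le> norm p \<longrightarrow> \<bar>u p + ln (1 + (norm p)\<^sup>2) - l\<bar> < \<epsilon>"
  using tendstoD[OF infinity assms] unfolding eventually_at_infinity by (simp add: dist_real_def)

text \<open>
  Both \<open>u p\<close> and \<open>u (reflection \<mu> p)\<close> follow \<open>l - ln (1 + \<bar>\<cdot>\<bar>\<^sup>2)\<close>, and the reflected point is the farther one.
\<close>
lemma gap_at_infinity: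
  assumes "\<mu> > 0" "\<epsilon> > 0"
  shows "\<exists>R. \<forall>p. R \<le> norm p \<longrightarrow> fst p < \<mu> \<longrightarrow> - \<epsilon> < gap \<mu> p"
proof -
  obtain R where R: "\<And>p. R \<le> norm p \<Longrightarrow> \<bar>u p + ln (1 + (norm p)\<^sup>2) - l\<bar> < \<epsilon> / 2"
    using u_at_infinity[of "\<epsilon> / 2"] assms by auto
  have "- \<epsilon> < gap \<mu> p" if p: "R \<le> norm p" "fst p < \<mu>" for p
  proof -
    let ?q = "reflection \<mu> p"
    have n: "norm p \<le> norm ?q" using reflection_norm[OF assms(1) p(2)] by simp
    then have "(norm p)\<^sup>2 \<le> (norm ?q)\<^sup>2" by (intro power_mono) auto
    then have "ln (1 + (norm p)\<^sup>2) \<le> ln (1 + (norm ?q)\<^sup>2)"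
      by (subst ln_le_cancel_iff) (auto intro: add_pos_nonneg)
    moreover have "\<bar>u p + ln (1 + (norm p)\<^sup>2) - l\<bar> < \<epsilon> / 2"
      "\<bar>u ?q + ln (1 + (norm ?q)\<^sup>2) - l\<bar> < \<epsilon> / 2" using R p n by auto
    ultimately show ?thesis unfolding gap_def by linarith
  qed
  then show ?thesis by blast
qed

lemma u_bounded_below:
  assumes "R > 0"
  shows "\<exists>m. \<forall>p. p \<noteq> 0 \<longrightarrow> norm p \<le> R \<longrightarrow> m \<le> u p"
proof -
  have "continuous_on (sphere 0 R) u" using assms by (intro continuous_on_subset[OF cont]) auto
  moreover have "sphere (0::real \<times> real) R \<noteq> {}" using assms by simp
  ultimately obtain p0 where p0: "\<And>p. p \<in> sphere 0 R \<Longrightarrow> u p0 \<le> u p"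
    using continuous_attains_inf[OF compact_sphere, of 0 R u] by blast
  have "u p0 \<le> u p" if "p \<noteq> 0" "norm p \<le> R" for p
  proof (rule superharmonic_min_punctured_disc[OF assms])
    show "continuous_on (cball 0 R - {0}) u" by (rule continuous_on_subset[OF cont]) auto
    show "superharmonic_on (ball 0 R - {0}) u"
      by (rule superharmonic_on_subset[OF superharmonic_u]) auto
    show "u p0 \<le> u p" if "norm p = R" for p using p0[of p] that by simp
  qed (use that origin in auto)
  then show ?thesis by blast
qed

text \<open>
  If the gap is negative at \<open>p\<close>, it satisfies there \<open>\<Delta> gap \<le> - c gap\<close> with \<open>c \<le> 2 C / (1 + \<bar>p\<bar>\<^sup>2)\<^sup>2\<close>. The positive
  function \<open>g\<close> satisfies \<open>\<Delta> g + c g < 0\<close> far out, thanks to \<open>1 / sqrt (1 + \<bar>p\<bar>\<^sup>2)\<close>, and close to the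
  reflection line, thanks to the exponential with large \<open>N\<close>. Hence no negative multiple of \<open>g\<close> can
  touch the gap from below in either region.
\<close>
lemma gap_barrier:
  fixes p :: "real \<times> real"
  assumes \<mu>: "\<mu> > 0" and p: "p \<noteq> 0" "fst p < \<mu>" and m: "m > 0"
    and C: "k (reflection \<mu> p) * exp (2 * u (reflection \<mu> p)) \<le> C / (1 + (norm p)\<^sup>2)\<^sup>2" "C \<ge> 0"
    and N: "norm p \<ge> 6 * C + 3 \<or> N\<^sup>2 * exp (N * (fst p - \<mu>)) \<ge> 6 * C + 3"
  defines "g \<equiv> (\<lambda>q. 3 - 1 / sqrt (1 + (norm q)\<^sup>2) - exp (N * (fst q - \<mu>)))"
  assumes g: "g p \<le> 3" "g p \<ge> 0" and touch: "gap \<mu> p = - m * g p"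
    and S: "open S" "p \<in> S" "\<And>q. q \<in> S \<Longrightarrow> - m * g q \<le> gap \<mu> q"
  shows False
proof -
  define q where "q = reflection \<mu> p"
  define s where "s = sqrt (1 + (norm p)\<^sup>2)"
  have s: "s \<ge> 1" "s\<^sup>2 = 1 + (norm p)\<^sup>2" "s \<ge> norm p"
    by (auto simp: s_def real_le_rsqrt add_nonneg_nonneg)
  define G where "G = 0 - ((norm p)\<^sup>2 - 2) / s ^ 5 - N\<^sup>2 * exp (N * (fst p - \<mu>))"
  define L where "L = - (k p * exp (2 * u p) + F p) + (k q * exp (2 * u q) + F q)"
  have lap_g: "has_laplacian g G p" unfolding g_def G_def s_def
    by (intro has_laplacian_diff has_laplacian_const has_laplacian_inverse_sqrt has_laplacian_exp_fst)
  have "has_laplacian (\<lambda>q. gap \<mu> q + m * g q) (L + m * G) p"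
    unfolding L_def q_def
    by (intro has_laplacian_add has_laplacian_cmult lap_g gap_laplacian \<mu> p)
  then have min: "L + m * G \<ge> 0"
    using S(1,2) by (rule has_laplacian_local_min) (use S(3) touch in fastforce)
  have "L \<le> k q * (exp (2 * u q) - exp (2 * u p))"
    using gap_laplacian_le[OF \<mu> p] by (simp add: L_def q_def)
  also have "u p = u q - m * g p" using touch by (simp add: gap_def q_def)
  also have "exp (2 * u q) - exp (2 * (u q - m * g p)) = exp (2 * u q) * (1 - exp (- (2 * (m * g p))))"
    by (simp add: right_diff_distrib flip: exp_add)
  (* 1 - exp (- x) \<le> x *)
  also have "k q * (exp (2 * u q) * (1 - exp (- (2 * (m * g p))))) \<le>
      k q * (exp (2 * u q) * (2 * (m * g p)))"
    using k_nonneg[OF reflection_norm(2)[OF \<mu> p(2)]] exp_ge_add_one_self[of "- (2 * (m * g p))"]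
    by (intro mult_left_mono) (auto simp: q_def)
  also have "\<dots> = (k q * exp (2 * u q)) * (2 * (m * g p))" by simp
  also have "\<dots> \<le> (C / (1 + (norm p)\<^sup>2)\<^sup>2) * (2 * (m * 3))"
    using C g m by (intro mult_mono) (auto simp: q_def)
  also have "\<dots> = m * (6 * C / s ^ 4)" by (simp add: s(2)[symmetric] flip: power_mult)
  finally have "m * (6 * C / s ^ 4 + G) \<ge> 0" using min by (simp add: distrib_left)
  then have le: "0 \<le> 6 * C / s ^ 4 + G" using m by (simp add: zero_le_mult_iff)
  show False
  proof (cases "norm p \<ge> 6 * C + 3")
    case True
    then have "s * (6 * C + 3) \<le> s * s" "s * 3 \<ge> 9" using s C(2) by (auto intro: mult_left_mono)
    then have "6 * C * s < (norm p)\<^sup>2 - 2" using s(2) by (simp add: power2_eq_square algebra_simps)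
    then have "6 * C * s / s ^ 5 < ((norm p)\<^sup>2 - 2) / s ^ 5"
      using s(1) by (intro divide_strict_right_mono) auto
    moreover have "6 * C * s / s ^ 5 = 6 * C / s ^ 4" using s(1) by (simp add: eval_nat_numeral)
    moreover have "N\<^sup>2 * exp (N * (fst p - \<mu>)) \<ge> 0" by simp
    ultimately show False using le unfolding G_def by linarith
  next
    case False
    then have "N\<^sup>2 * exp (N * (fst p - \<mu>)) \<ge> 6 * C + 3" using N by simp
    moreover have "6 * C / s ^ 4 \<le> 6 * C" 
      using s(1) C(2) by (simp add: divide_le_eq mult_le_cancel_left1)
    moreover have "((norm p)\<^sup>2 - 2) / s ^ 5 \<ge> - 2"
    proof -
      have "- 2 * s ^ 5 \<le> - 2" using one_le_power[OF s(1), of 5] by simp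
      also have "\<dots> \<le> (norm p)\<^sup>2 - 2" by simp
      finally show ?thesis using s(1) by (simp add: le_divide_eq)
    qed
    ultimately show False using le unfolding G_def by linarith
  qed
qed

text \<open>
  Nonnegativity of the gap has to be checked only on a bounded set that keeps a distance from the
  reflection line, and the same bounds work for all \<open>\<mu> \<ge> m0\<close>. Indeed a negative minimum of \<open>gap / g\<close>
  exists because the gap is asymptotically nonnegative at infinity and vanishes on the line, and by
  \<open>gap_barrier\<close> it can only lie in that set. The uniformity in \<open>\<mu>\<close> replaces the Hopf lemma when the
  line is moved.
\<close>
lemma narrow_region:
  assumes "m0 > 0"
  obtains R0 \<eta> where "R0 > 0" "\<eta> > 0" "\<forall>\<mu>\<ge>m0.
    (\<forall>p. p \<noteq> 0 \<longrightarrow> norm p \<le> R0 \<longrightarrow> fst p \<le> \<mu> - \<eta> \<longrightarrow> 0 \<le> gap \<mu> p) \<longrightarrow> dominated \<mu>"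
proof -
  obtain C where C: "\<And>p. m0 \<le> norm p \<Longrightarrow> k p * exp (2 * u p) \<le> C / (1 + (norm p)\<^sup>2)\<^sup>2"
    using decay[OF assms] by blast
  have "C \<ge> 0"
  proof -
    have "(m0, 0) \<noteq> (0::real \<times> real)" "m0 \<le> norm (m0, 0::real)" using assms by (auto simp: zero_prod_def)
    then have "0 \<le> C / (1 + (norm (m0, 0::real))\<^sup>2)\<^sup>2"
      using C[of "(m0, 0)"] k_nonneg[of "(m0, 0)"] by (meson exp_ge_zero mult_nonneg_nonneg order_trans)
    moreover have "(1 + (norm (m0, 0::real))\<^sup>2)\<^sup>2 > 0"
      by (intro zero_less_power add_pos_nonneg) auto
    ultimately show ?thesis by (simp add: zero_le_divide_iff)
  qed
  define R0 where "R0 = 6 * C + 3"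
  (* the first summand makes N^2 / exp 1 at least 6 C + 3, as needed on the strip of width
     1 / N; the second keeps the origin out of that strip *)
  define N where "N = exp 1 * (6 * C + 3) + 2 / m0"
  define \<eta> where "\<eta> = 1 / N"
  have N1: "N \<ge> exp 1 * (6 * C + 3)" "N \<ge> 2 / m0" using assms \<open>C \<ge> 0\<close> by (auto simp: N_def)
  have "exp 1 * (6 * C + 3) \<ge> 1 * (1::real)" using \<open>C \<ge> 0\<close> by (intro mult_mono) auto
  then have N2: "N \<ge> 1" using N1 by linarith
  have R0: "R0 > 0" using \<open>C \<ge> 0\<close> by (simp add: R0_def)
  have \<eta>: "\<eta> > 0" "\<eta> < m0" using N2 N1(2) assms by (auto simp: \<eta>_def field_simps)
  have "dominated \<mu>"
    if \<mu>: "\<mu> \<ge> m0" and core: "\<And>p. p \<noteq> 0 \<Longrightarrow> norm p \<le> R0 \<Longrightarrow> fst p \<le> \<mu> - \<eta> \<Longrightarrow> 0 \<le> gap \<mu> p" for \<mu>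
  proof (rule ccontr)
    assume "\<not> dominated \<mu>"
    then obtain p1 where p1: "p1 \<noteq> 0" "fst p1 < \<mu>" "gap \<mu> p1 < 0"
      unfolding dominated_def by (meson not_le)
    have \<mu>0: "\<mu> > 0" using \<mu> assms by simp
    define g where "g = (\<lambda>q::real \<times> real. 3 - 1 / sqrt (1 + (norm q)\<^sup>2) - exp (N * (fst q - \<mu>)))"
    have g: "1 \<le> g q" "g q \<le> 3" if "fst q \<le> \<mu>" for q
    proof -
      have "1 / sqrt (1 + (norm q)\<^sup>2) \<le> 1" by (simp add: divide_le_eq add_pos_nonneg)
      moreover have "N * (fst q - \<mu>) \<le> 0" using that N2 by (simp add: mult_nonneg_nonpos)
      then have "exp (N * (fst q - \<mu>)) \<le> 1" by simp
      ultimately show "1 \<le> g q" unfolding g_def by linarith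
      have "1 / sqrt (1 + (norm q)\<^sup>2) \<ge> 0" "exp (N * (fst q - \<mu>)) \<ge> 0" by simp_all
      then show "g q \<le> 3" unfolding g_def by linarith
    qed
    define z where "z = (\<lambda>q. gap \<mu> q / g q)"
    have zp1: "z p1 < 0" using g[of p1] p1 by (simp add: z_def divide_neg_pos)
    obtain R1 where R1: "\<And>p. R1 \<le> norm p \<Longrightarrow> fst p < \<mu> \<Longrightarrow> z p1 < gap \<mu> p"
      using gap_at_infinity[OF \<mu>0, of "- z p1"] zp1 unfolding neg_0_less_iff_less minus_minus by blast
    have far: "z p1 < z p" if "R1 \<le> norm p" "fst p < \<mu>" for p
    proof (cases "gap \<mu> p < 0")
      case True
      then have "gap \<mu> p \<le> z p" using g[of p] that by (simp add: z_def le_divide_eq mult_le_cancel_left1)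
      then show ?thesis using R1[OF that] by simp
    next
      case False
      then have "z p \<ge> 0" using g[of p] that by (simp add: z_def)
      then show ?thesis using zp1 by simp
    qed
    define D where "D = (cball 0 R1 \<inter> {p::real \<times> real. fst p \<le> \<mu>}) - (ball 0 R0 \<inter> {p. fst p < \<mu> - \<eta>})"
    have "compact D" unfolding D_def
      by (intro compact_diff compact_Int_closed open_Int closed_Collect_le open_Collect_less continuous_intros) auto
    moreover have p1D: "p1 \<in> D"
      using p1 far[of p1] core[of p1] by (force simp: D_def)
    moreover have D0: "0 \<notin> D" using R0 \<eta> \<mu> by (auto simp: D_def)
    have gcont: "continuous_on D g" unfolding g_def
      by (intro continuous_intros) (auto simp: add_nonneg_eq_0_iff)
    have Dsub: "D \<subseteq> {p. fst p \<le> \<mu>} - {0}" using D0 by (auto simp: D_def)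
    have gnz: "g q \<noteq> 0" if "q \<in> D" for q
    proof -
      have "fst q \<le> \<mu>" using that Dsub by blast
      then show ?thesis using g[of q] by simp
    qed
    have "continuous_on D z" unfolding z_def
      using gnz by (intro continuous_on_divide gcont continuous_on_subset[OF continuous_on_gap[OF \<mu>0] Dsub]) blast
    ultimately obtain p where p: "p \<in> D" "\<And>q. q \<in> D \<Longrightarrow> z p \<le> z q"
      using continuous_attains_inf[of D z] by blast
    have zp: "z p < 0" using p(2)[OF p1D] zp1 by simp
    have glob: "z p \<le> z q" if q: "q \<noteq> 0" "fst q < \<mu>" for q
    proof (cases "q \<in> D")
      case False
      then consider "R1 \<le> norm q" | "norm q \<le> R0" "fst q \<le> \<mu> - \<eta>" using q by (force simp: D_def)
      then show ?thesis
      proof cases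
        case 1 then show ?thesis using far[of q] q p(2)[OF p1D] by simp
      next
        case 2
        then have "0 \<le> z q" using core[of q] q g[of q] by (simp add: z_def)
        then show ?thesis using zp by simp
      qed
    qed (rule p(2))
    have pnz: "p \<noteq> 0" using p D0 by auto
    have gneg: "gap \<mu> p < 0" using zp g[of p] p(1) by (simp add: z_def D_def divide_less_0_iff)
    have "fst p \<noteq> \<mu>"
    proof
      assume "fst p = \<mu>"
      then have "reflection \<mu> p = p" by (simp add: reflection_def prod_eq_iff)
      then show False using gneg by (simp add: gap_def)
    qed
    then have pmu: "fst p < \<mu>" using p(1) by (simp add: D_def)
    have region: "norm p \<ge> R0 \<or> fst p > \<mu> - \<eta>" using core[of p] pnz gneg by force
    have m: "- z p > 0" using zp by simp
    show False
    proof (rule gap_barrier[OF \<mu>0 pnz pmu m _ \<open>C \<ge> 0\<close>, of N])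
      let ?q = "reflection \<mu> p"
      have "k ?q * exp (2 * u ?q) \<le> C / (1 + (norm ?q)\<^sup>2)\<^sup>2"
        using C reflection_norm[OF \<mu>0 pmu] \<mu> by simp
      also have "\<dots> \<le> C / (1 + (norm p)\<^sup>2)\<^sup>2"
        using reflection_norm(1)[OF \<mu>0 pmu] \<open>C \<ge> 0\<close>
        by (intro divide_left_mono power_mono add_left_mono mult_pos_pos zero_less_power)
           (auto intro: add_pos_nonneg)
      finally show "k ?q * exp (2 * u ?q) \<le> C / (1 + (norm p)\<^sup>2)\<^sup>2" .
      show "6 * C + 3 \<le> norm p \<or> 6 * C + 3 \<le> N\<^sup>2 * exp (N * (fst p - \<mu>))"
      proof (rule disj_imp[THEN iffD2], rule impI)
        assume "\<not> 6 * C + 3 \<le> norm p"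
        then have "fst p - \<mu> > - \<eta>" using region by (simp add: R0_def)
        then have "N * (fst p - \<mu>) \<ge> N * (- \<eta>)" using N2 by (intro mult_left_mono) auto
        then have e: "exp (N * (fst p - \<mu>)) \<ge> exp (- 1)" using N2 by (simp add: \<eta>_def)
        have "6 * C + 3 \<le> N * exp (- 1)" using N1(1) by (simp add: exp_minus field_simps)
        also have "\<dots> \<le> N * (N * exp (- 1))" using N2 by (intro mult_left_mono) auto
        also have "\<dots> \<le> N\<^sup>2 * exp (N * (fst p - \<mu>))"
          unfolding mult.assoc[symmetric] power2_eq_square using e N2 by (intro mult_left_mono) auto
        finally show "6 * C + 3 \<le> N\<^sup>2 * exp (N * (fst p - \<mu>))" .
      qed
      show "3 - 1 / sqrt (1 + (norm p)\<^sup>2) - exp (N * (fst p - \<mu>)) \<le> 3"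
        "0 \<le> 3 - 1 / sqrt (1 + (norm p)\<^sup>2) - exp (N * (fst p - \<mu>))"
        using g[of p] pmu by (auto simp: g_def)
      show "gap \<mu> p = - (- z p) * (3 - 1 / sqrt (1 + (norm p)\<^sup>2) - exp (N * (fst p - \<mu>)))"
        using g[of p] pmu by (simp add: z_def g_def)
      have "open ({q. fst q < \<mu>} - {0::real \<times> real})"
        by (intro open_delete open_Collect_less continuous_intros)
      then show "open ({q. fst q < \<mu>} - {0::real \<times> real})" .
      show "p \<in> {q. fst q < \<mu>} - {0}" using pmu pnz by simp
      show "- (- z p) * (3 - 1 / sqrt (1 + (norm q)\<^sup>2) - exp (N * (fst q - \<mu>))) \<le> gap \<mu> q"
        if q: "q \<in> {q. fst q < \<mu>} - {0}" for q
      proof -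
        have "z p \<le> gap \<mu> q / g q" using glob[of q] q by (simp add: z_def)
        then have "z p * g q \<le> gap \<mu> q" using g[of q] q by (simp add: le_divide_eq)
        then show ?thesis by (simp add: g_def)
      qed
    qed
  qed
  then show ?thesis by (intro that[OF R0 \<eta>(1)] allI impI) blast
qed

text \<open>
  On a fixed disc \<open>u\<close> is bounded below, whereas the reflection of the disc in a distant line lies
  where \<open>u\<close> is very negative.
\<close>
lemma dominated_start: "\<exists>M>0. \<forall>\<mu>\<ge>M. dominated \<mu>"
proof -
  obtain R0 \<eta> where R0: "R0 > 0" and \<eta>: "\<eta> > 0" and nr: "\<forall>\<mu>\<ge>1.
    (\<forall>p. p \<noteq> 0 \<longrightarrow> norm p \<le> R0 \<longrightarrow> fst p \<le> \<mu> - \<eta> \<longrightarrow> 0 \<le> gap \<mu> p) \<longrightarrow> dominated \<mu>"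
    by (rule narrow_region[OF zero_less_one])
  obtain m where m: "\<And>p. p \<noteq> 0 \<Longrightarrow> norm p \<le> R0 \<Longrightarrow> m \<le> u p"
    using u_bounded_below[OF R0] by blast
  obtain R where R: "\<And>p. R \<le> norm p \<Longrightarrow> \<bar>u p + ln (1 + (norm p)\<^sup>2) - l\<bar> < 1"
    using u_at_infinity[of 1] by auto
  define M where "M = Max {1, R + R0, exp (l + 1 - m) + R0}"
  have "dominated \<mu>" if \<mu>: "\<mu> \<ge> M" for \<mu>
  proof (rule nr[rule_format])
    show "\<mu> \<ge> 1" using \<mu> by (simp add: M_def)
    fix p :: "real \<times> real" assume p: "p \<noteq> 0" "norm p \<le> R0"
    let ?q = "reflection \<mu> p"
    have "norm ?q \<ge> 2 * \<mu> - fst p" using fst_le_norm[of ?q] by (simp add: reflection_def)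
    then have "norm ?q \<ge> \<mu> - R0" using fst_le_norm[of p] p \<open>\<mu> \<ge> 1\<close> by simp
    then have q: "R \<le> norm ?q" "exp (l + 1 - m) \<le> norm ?q" using \<mu> by (auto simp: M_def)
    have "norm ?q \<le> 1 + (norm ?q)\<^sup>2"
      using zero_le_power2[of "norm ?q - 1"] norm_ge_zero[of ?q] unfolding power2_diff power_one mult_1_right by linarith
    then have "exp (l + 1 - m) \<le> 1 + (norm ?q)\<^sup>2" using q by simp
    then have "l + 1 - m \<le> ln (1 + (norm ?q)\<^sup>2)" by (simp add: ln_ge_iff add_pos_nonneg)
    then have "u ?q \<le> m" using R[OF q(1)] by linarith
    then show "0 \<le> gap \<mu> p" using m[OF p] by (simp add: gap_def)
  qed
  moreover have "M > 0" by (simp add: M_def)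
  ultimately show ?thesis by blast
qed

text \<open>
  By the strong minimum principle the gap could only vanish identically. Then its Laplacian
  vanishes too, which forces both coefficients to agree with their reflections.
\<close>
lemma gap_pos:
  assumes \<mu>: "\<mu> > 0" and dom: "dominated \<mu>" and p: "p \<noteq> 0" "fst p < \<mu>"
  shows "gap \<mu> p > 0"
proof (rule ccontr)
  assume "\<not> gap \<mu> p > 0"
  then have zero: "gap \<mu> p = 0" using dominatedD[OF dom p] by simp
  let ?\<Omega> = "{p. fst p < \<mu>} - {0::real \<times> real}"
  have op: "open {p::real \<times> real. fst p < \<mu>}" by (intro open_Collect_less continuous_intros)
  have cvx: "convex {p::real \<times> real. fst p < \<mu>}"
    using convex_linear_vimage[OF bounded_linear.linear[OF bounded_linear_fst], of "{..<\<mu>}"]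
    by (simp add: vimage_def)
  have op': "open ?\<Omega>" using op by (rule open_delete)
  have conn: "connected ?\<Omega>"
    by (rule connected_open_delete[OF op convex_connected[OF cvx]]) simp
  have contg: "continuous_on ?\<Omega> (gap \<mu>)" by (rule continuous_on_subset[OF continuous_on_gap[OF \<mu>]]) auto
  have nonneg: "0 \<le> gap \<mu> q" if "q \<in> ?\<Omega>" for q using that by (intro dominatedD[OF dom]) auto
  have "p \<in> ?\<Omega>" using p by simp
  note all = strong_minimum_principle[OF op' conn contg superharmonic_gap[OF \<mu> dom] nonneg this zero]
  obtain q where q: "q \<noteq> 0" "fst q < \<mu>" "k (reflection \<mu> q) \<noteq> k q \<or> F (reflection \<mu> q) \<noteq> F q"
    using nondegenerate[OF \<mu>] by blast
  let ?r = "reflection \<mu> q"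
  have "- (k q * exp (2 * u q) + F q) + (k ?r * exp (2 * u ?r) + F ?r) \<ge> 0"
    using gap_laplacian[OF \<mu> q(1,2)] op' by (rule has_laplacian_local_min) (use all q in auto)
  moreover have "u ?r = u q" using all[of q] q by (simp add: gap_def)
  ultimately have "(k q - k ?r) * exp (2 * u q) + (F q - F ?r) \<le> 0" by (simp add: algebra_simps)
  moreover have "F ?r \<le> F q" "k ?r \<le> k q"
    using F_antimono[OF q(1)] k_antimono[OF q(1)] reflection_norm(1)[OF \<mu> q(2)] by auto
  moreover from this have "(k q - k ?r) * exp (2 * u q) \<ge> 0" by simp
  ultimately have "F ?r = F q" "(k q - k ?r) * exp (2 * u q) = 0" by linarith+
  then show False using q(3) by simp
qed

text \<open>
  Away from the line and from infinity the gap has a positive lower bound; near the origin, where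
  \<open>u\<close> may be unbounded, this follows from the minimum principle on the punctured disc. The
  reflected function changes uniformly little with \<open>\<mu>\<close>, since the reflected points stay away from
  the origin, so the bound survives and \<open>narrow_region\<close> applies.
\<close>
lemma dominated_open:
  assumes \<mu>0: "\<mu>0 > 0" and dom: "dominated \<mu>0"
  shows "\<exists>\<epsilon>>0. \<forall>\<mu>. \<mu>0 - \<epsilon> < \<mu> \<longrightarrow> \<mu> \<le> \<mu>0 \<longrightarrow> dominated \<mu>"
proof -
  obtain R0 \<eta> where R0: "R0 > 0" and \<eta>: "\<eta> > 0" and nr: "\<forall>\<mu>\<ge>\<mu>0 / 2.
    (\<forall>p. p \<noteq> 0 \<longrightarrow> norm p \<le> R0 \<longrightarrow> fst p \<le> \<mu> - \<eta> \<longrightarrow> 0 \<le> gap \<mu> p) \<longrightarrow> dominated \<mu>"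
    by (rule narrow_region[OF half_gt_zero[OF \<mu>0]])
  define E where "E = cball 0 R0 \<inter> {p::real \<times> real. fst p \<le> \<mu>0 - \<eta> / 2}"
  define r where "r = min 1 (\<mu>0 / 2)"
  have r: "0 < r" "r \<le> 1" "r < \<mu>0" using \<mu>0 by (auto simp: r_def)
  have ball: "cball 0 r \<subseteq> {p::real \<times> real. fst p < \<mu>0}"
  proof (rule subsetI)
    fix p :: "real \<times> real" assume "p \<in> cball 0 r"
    then show "p \<in> {p. fst p < \<mu>0}" using r(3) fst_le_norm[of p] by simp
  qed
  have contgap: "continuous_on ({p. fst p < \<mu>0} - {0}) (gap \<mu>0)"
    by (rule continuous_on_subset[OF continuous_on_gap[OF \<mu>0]]) auto
  have pos_min: "\<exists>\<delta>>0. \<forall>p\<in>T. \<delta> \<le> gap \<mu>0 p"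
    if T: "compact T" "T \<subseteq> {p. fst p < \<mu>0} - {0}" for T
  proof (cases "T = {}")
    case False
    then obtain p where p: "p \<in> T" "\<And>q. q \<in> T \<Longrightarrow> gap \<mu>0 p \<le> gap \<mu>0 q"
      using continuous_attains_inf[OF T(1) _ continuous_on_subset[OF contgap T(2)]] by blast
    have "gap \<mu>0 p > 0" using p(1) T(2) by (intro gap_pos[OF \<mu>0 dom]) auto
    then show ?thesis using p(2) by blast
  qed (auto intro: exI[of _ 1])
  have "sphere 0 r \<subseteq> {p::real \<times> real. fst p < \<mu>0} - {0}"
    using subset_trans[OF sphere_cball ball] r(1) unfolding subset_Diff_insert by simp
  then obtain \<delta>1 where \<delta>1: "\<delta>1 > 0" "\<And>p. p \<in> sphere 0 r \<Longrightarrow> \<delta>1 \<le> gap \<mu>0 p"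
    using pos_min[of "sphere 0 r"] by auto
  have inner: "\<delta>1 \<le> gap \<mu>0 p" if p: "p \<noteq> 0" "norm p \<le> r" for p
  proof (rule superharmonic_min_punctured_disc[OF r(1)])
    show "continuous_on (cball 0 r - {0}) (gap \<mu>0)"
      using ball by (intro continuous_on_subset[OF contgap]) auto
    show "superharmonic_on (ball 0 r - {0}) (gap \<mu>0)"
      by (rule superharmonic_on_subset[OF superharmonic_gap[OF \<mu>0 dom]
            Diff_mono[OF subset_trans[OF ball_subset_cball ball] order_refl]])
    show "\<delta>1 \<le> gap \<mu>0 p" if "norm p = r" for p using \<delta>1(2)[of p] that by simp
    show "\<exists>\<delta>>0. \<forall>p. 0 < norm p \<and> norm p < \<delta> \<longrightarrow> \<epsilon> * ln (norm p) \<le> gap \<mu>0 p" if "\<epsilon> > 0" for \<epsilon>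
    proof (intro exI[of _ r] conjI allI impI r(1))
      fix p :: "real \<times> real" assume p: "0 < norm p \<and> norm p < r"
      then have "\<epsilon> * ln (norm p) \<le> 0" using r(2) that by (intro mult_nonneg_nonpos) auto
      moreover have "gap \<mu>0 p \<ge> 0"
        using subsetD[OF ball, of p] p by (intro dominatedD[OF dom]) auto
      ultimately show "\<epsilon> * ln (norm p) \<le> gap \<mu>0 p" by simp
    qed
  qed (use p in auto)
  have "compact (E - ball 0 r)" unfolding E_def
    by (intro compact_diff compact_Int_closed closed_Collect_le continuous_intros) auto
  moreover have "E - ball 0 r \<subseteq> {p. fst p < \<mu>0} - {0}" using \<eta> r(1) by (auto simp: E_def)
  ultimately obtain \<delta>2 where \<delta>2: "\<delta>2 > 0" "\<And>p. p \<in> E - ball 0 r \<Longrightarrow> \<delta>2 \<le> gap \<mu>0 p"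
    using pos_min[of "E - ball 0 r"] by auto
  define \<delta> where "\<delta> = min \<delta>1 \<delta>2"
  have \<delta>: "\<delta> > 0" "\<And>p. p \<in> E \<Longrightarrow> p \<noteq> 0 \<Longrightarrow> \<delta> \<le> gap \<mu>0 p"
  proof -
    show "\<delta> > 0" using \<delta>1 \<delta>2 by (simp add: \<delta>_def)
    fix p assume "p \<in> E" "p \<noteq> 0"
    then show "\<delta> \<le> gap \<mu>0 p" using inner[of p] \<delta>2(2)[of p]
      by (cases "norm p \<le> r") (auto simp: \<delta>_def min_le_iff_disj)
  qed
  define T where "T = cball 0 (2 * \<mu>0 + 2 * R0) \<inter> {p::real \<times> real. \<mu>0 \<le> fst p}"
  have "compact T" unfolding T_def
    by (intro compact_Int_closed closed_Collect_le continuous_intros) auto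
  moreover have "continuous_on T u" using \<mu>0
    by (intro continuous_on_subset[OF cont]) (auto simp: T_def)
  ultimately have "uniformly_continuous_on T u" by (rule compact_uniformly_continuous[rotated])
  then obtain d where d: "d > 0"
    "\<And>x y. x \<in> T \<Longrightarrow> y \<in> T \<Longrightarrow> dist y x < d \<Longrightarrow> dist (u y) (u x) < \<delta>"
    using \<delta>(1) unfolding uniformly_continuous_on_def by blast
  define \<epsilon> where "\<epsilon> = Min {\<eta> / 4, d / 2, \<mu>0 / 2}"
  have \<epsilon>: "\<epsilon> > 0" "\<epsilon> \<le> \<eta> / 4" "\<epsilon> \<le> d / 2" "\<epsilon> \<le> \<mu>0 / 2" using \<eta> d(1) \<mu>0 by (auto simp: \<epsilon>_def)
  have "dominated \<mu>" if \<mu>: "\<mu>0 - \<epsilon> < \<mu>" "\<mu> \<le> \<mu>0" for \<mu>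
  proof (rule nr[rule_format])
    show "\<mu> \<ge> \<mu>0 / 2" using \<mu> \<epsilon>(4) by linarith
    fix p :: "real \<times> real" assume p: "p \<noteq> 0" "norm p \<le> R0" "fst p \<le> \<mu> - \<eta>"
    have pE: "p \<in> E" using p \<mu> \<eta> by (simp add: E_def)
    have inT: "reflection \<nu> p \<in> T" if "\<mu> \<le> \<nu>" "\<nu> \<le> \<mu>0" for \<nu>
    proof -
      have "norm (reflection \<nu> p) \<le> \<bar>2 * \<nu> - fst p\<bar> + \<bar>snd p\<bar>"
        using norm_Pair_le[of "2 * \<nu> - fst p" "snd p"] by (simp add: reflection_def)
      moreover have "\<bar>fst p\<bar> \<le> R0" "\<bar>snd p\<bar> \<le> R0"
        using norm_fst_le[of "fst p" "snd p"] norm_snd_le[of "snd p" "fst p"] p by auto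
      ultimately have "norm (reflection \<nu> p) \<le> 2 * \<mu>0 + 2 * R0"
        using that \<mu> \<epsilon>(4) \<mu>0 by (simp add: abs_if split: if_splits)
      moreover have "fst (reflection \<nu> p) \<ge> \<mu>0"
        using that p \<mu> \<epsilon>(2) \<eta> by (simp add: reflection_def)
      ultimately show ?thesis by (simp add: T_def)
    qed
    have "dist (reflection \<mu> p) (reflection \<mu>0 p) = 2 * (\<mu>0 - \<mu>)"
      using \<mu> by (simp add: reflection_def dist_Pair_Pair dist_real_def)
    then have "dist (u (reflection \<mu> p)) (u (reflection \<mu>0 p)) < \<delta>"
      using \<mu> \<epsilon>(3) by (intro d(2) inT) auto
    then show "0 \<le> gap \<mu> p" using \<delta>(2)[OF pE p(1)] by (simp add: gap_def dist_real_def)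
  qed
  then show ?thesis using \<epsilon>(1) by blast
qed

lemma dominated_limit:
  assumes dom: "\<And>\<mu>'. \<mu> < \<mu>' \<Longrightarrow> dominated \<mu>'" and \<mu>: "\<mu> \<ge> 0" and p: "p \<noteq> 0" "fst p < \<mu>"
  shows "0 \<le> gap \<mu> p"
proof -
  have "reflection \<mu> p \<noteq> 0" using \<mu> p by (auto simp: reflection_def zero_prod_def)
  then have "isCont u (reflection \<mu> p)" by (rule isCont_u)
  moreover have "((\<lambda>\<mu>'. reflection \<mu>' p) \<longlongrightarrow> reflection \<mu> p) (at_right \<mu>)"
    unfolding reflection_def by (intro tendsto_intros)
  ultimately have "((\<lambda>\<mu>'. u (reflection \<mu>' p)) \<longlongrightarrow> u (reflection \<mu> p)) (at_right \<mu>)"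
    by (rule isCont_tendsto_compose)
  then have "((\<lambda>\<mu>'. gap \<mu>' p) \<longlongrightarrow> gap \<mu> p) (at_right \<mu>)"
    unfolding gap_def by (rule tendsto_diff[OF tendsto_const])
  moreover have "\<forall>\<^sub>F \<mu>' in at_right \<mu>. 0 \<le> gap \<mu>' p"
    using p by (auto simp: eventually_at_right_field intro!: exI[of _ "\<mu> + 1"] dominatedD[OF dom])
  ultimately show ?thesis by (rule tendsto_lowerbound) simp
qed

lemma dominated_all:
  assumes "\<mu> > 0"
  shows "dominated \<mu>"
proof (rule ccontr)
  assume neg: "\<not> dominated \<mu>"
  define A where "A = {\<nu>. \<mu> \<le> \<nu> \<and> (\<forall>\<mu>'\<ge>\<nu>. dominated \<mu>')}"
  obtain M where "M > 0" "\<forall>\<mu>\<ge>M. dominated \<mu>" using dominated_start by blast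
  then have "max M \<mu> \<in> A" by (auto simp: A_def)
  then have ne: "A \<noteq> {}" by blast
  have bdd: "bdd_below A" by (auto simp: A_def)
  define \<mu>0 where "\<mu>0 = Inf A"
  have \<mu>0: "\<mu> \<le> \<mu>0" unfolding \<mu>0_def using ne by (rule cInf_greatest) (auto simp: A_def)
  have above: "dominated \<mu>'" if "\<mu>0 < \<mu>'" for \<mu>'
  proof -
    obtain \<nu> where "\<nu> \<in> A" "\<nu> < \<mu>'" using cInf_lessD[OF ne, of \<mu>'] \<open>\<mu>0 < \<mu>'\<close> unfolding \<mu>0_def by blast
    then show ?thesis by (simp add: A_def)
  qed
  then have dom0: "dominated \<mu>0"
    using dominated_limit[of \<mu>0] \<mu>0 assms unfolding dominated_def[of \<mu>0] by fastforce
  obtain \<epsilon> where \<epsilon>: "\<epsilon> > 0" "\<And>\<mu>'. \<mu>0 - \<epsilon> < \<mu>' \<Longrightarrow> \<mu>' \<le> \<mu>0 \<Longrightarrow> dominated \<mu>'"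
    using dominated_open[OF _ dom0] \<mu>0 assms by auto
  have dom': "dominated \<mu>'" if "\<mu>0 - \<epsilon> < \<mu>'" for \<mu>'
    using \<epsilon>(2)[OF that] above[of \<mu>'] by fastforce
  then have "\<mu> \<le> \<mu>0 - \<epsilon>" using neg by force
  then have "\<mu>0 - \<epsilon> / 2 \<in> A" using \<epsilon>(1) by (auto simp: A_def intro!: dom')
  then have "\<mu>0 \<le> \<mu>0 - \<epsilon> / 2" unfolding \<mu>0_def using bdd by (rule cInf_lower)
  then show False using \<epsilon>(1) by simp
qed

lemma reflection_inequality:
  assumes "x < 0"
  shows "u (- x, y) \<le> u (x, y)"
  using dominated_limit[of 0 "(x, y)"] dominated_all assms
  by (simp add: gap_def reflection_def zero_prod_def)

end

section \<open>Gradient and Laplace-Beltrami operator on the sphere\<close>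

lemma inner_north: "x \<bullet> north = x $ 3"
  by (simp add: north_def inner_vec_def sum_3 vector_3)

lemma north_sphere: "north \<bullet> north = 1" "north \<in> S2" "south = - north"
proof -
  show "north \<bullet> north = 1" by (simp add: inner_north) (simp add: north_def vector_3)
  then show "north \<in> S2" by (simp add: norm_eq_1)
  show "south = - north" by (simp add: vec_eq_iff forall_3 north_def south_def vector_3)
qed

lemma in_S2: "x \<in> S2 \<longleftrightarrow> x \<bullet> x = 1"
  by (simp add: norm_eq_1)

lemmas S2_inner_self = in_S2[THEN iffD1]

lemma orthonormal_expansion:
  fixes a b c x :: "real^3"
  assumes "a \<bullet> a = 1" "b \<bullet> b = 1" "c \<bullet> c = 1" "a \<bullet> b = 0" "a \<bullet> c = 0" "b \<bullet> c = 0"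
  shows "x = (x \<bullet> a) *\<^sub>R a + (x \<bullet> b) *\<^sub>R b + (x \<bullet> c) *\<^sub>R c"
proof -
  let ?B = "{a, b, c}"
  have dist: "a \<noteq> b" "a \<noteq> c" "b \<noteq> c" using assms by auto
  have orth: "pairwise orthogonal ?B"
    using assms by (auto simp: pairwise_def orthogonal_def inner_commute)
  have norm1: "norm v = 1" if "v \<in> ?B" for v using that assms by (auto simp: norm_eq_1)
  have "independent ?B"
    using orth norm1 by (intro pairwise_orthogonal_independent) force+
  then have "span ?B = UNIV"
    using dist card_ge_dim_independent[of ?B UNIV] by (auto simp: dim_UNIV card_insert_if)
  then have "(\<Sum>v\<in>?B. (x \<bullet> v) *\<^sub>R v) = x"
    using orth norm1 by (intro orthonormal_basis_expand) auto
  then show ?thesis using dist by (simp add: add.assoc)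
qed

text \<open>
  Within the sphere the normal component of an increment is quadratically small.
\<close>
lemma height_has_derivative_zero:
  assumes "\<theta> \<in> S2"
  shows "((\<lambda>y. \<theta> \<bullet> y) has_derivative (\<lambda>h. 0)) (at \<theta> within S2)"
proof (rule has_derivative_transform[of \<theta> S2 _ "\<lambda>y. 1 - ((y - \<theta>) \<bullet> (y - \<theta>)) / 2"])
  show "\<theta> \<in> S2" by fact
  show "\<theta> \<bullet> y = 1 - (y - \<theta>) \<bullet> (y - \<theta>) / 2" if "y \<in> S2" for y
    using S2_inner_self[OF that] S2_inner_self[OF assms]
    by (simp add: inner_diff inner_commute[of y \<theta>] field_simps)
  show "((\<lambda>y. 1 - (y - \<theta>) \<bullet> (y - \<theta>) / 2) has_derivative (\<lambda>h. 0)) (at \<theta> within S2)"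
    by (auto intro!: derivative_eq_intros)
qed

lemma tangent_curve:
  assumes "\<theta> \<in> S2" "e \<in> S2" "e \<bullet> \<theta> = 0"
  shows "\<And>t. cos t *\<^sub>R \<theta> + sin t *\<^sub>R e \<in> S2"
    and "\<And>t. ((\<lambda>t. cos t *\<^sub>R \<theta> + sin t *\<^sub>R e) has_vector_derivative (- sin t *\<^sub>R \<theta> + cos t *\<^sub>R e)) (at t within T)"
proof -
  show "cos t *\<^sub>R \<theta> + sin t *\<^sub>R e \<in> S2" for t
  proof -
    have "(cos t *\<^sub>R \<theta> + sin t *\<^sub>R e) \<bullet> (cos t *\<^sub>R \<theta> + sin t *\<^sub>R e) = (cos t)\<^sup>2 * (\<theta> \<bullet> \<theta>) + (sin t)\<^sup>2 * (e \<bullet> e)"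
      using assms(3) by (simp add: inner_add inner_commute[of \<theta> e] power2_eq_square)
    then show ?thesis unfolding in_S2 by (simp add: S2_inner_self[OF assms(1)] S2_inner_self[OF assms(2)])
  qed
  show "((\<lambda>t. cos t *\<^sub>R \<theta> + sin t *\<^sub>R e) has_vector_derivative (- sin t *\<^sub>R \<theta> + cos t *\<^sub>R e)) (at t within T)" for t
    by (auto intro!: derivative_eq_intros simp: has_vector_derivative_def algebra_simps)
qed

text \<open>
  A derivative within the sphere may be changed in the normal direction, so one can be represented
  by a tangent vector; differentiating along great circles shows that this vector is unique.
\<close>
lemma sphere_grad_works:
  assumes \<theta>: "\<theta> \<in> S2" and diff: "u differentiable (at \<theta> within S2)"
  shows "sphere_grad u \<theta> \<bullet> \<theta> = 0"
    and "(u has_derivative (\<lambda>h. sphere_grad u \<theta> \<bullet> h)) (at \<theta> within S2)"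
proof -
  let ?P = "\<lambda>g. g \<bullet> \<theta> = 0 \<and> (u has_derivative (\<lambda>h. g \<bullet> h)) (at \<theta> within S2)"
  have tt: "\<theta> \<bullet> \<theta> = 1" by (rule S2_inner_self[OF \<theta>])
  have "\<exists>!g. ?P g"
  proof (rule ex_ex1I)
    obtain D where D: "(u has_derivative D) (at \<theta> within S2)" using diff by (auto simp: differentiable_def)
    define g0 where "g0 = adjoint D 1"
    have D_eq: "D = (\<lambda>h. g0 \<bullet> h)"
      using adjoint_works[OF has_derivative_linear[OF D], of _ 1] by (auto simp: g0_def inner_commute)
    define c where "c = g0 \<bullet> \<theta>"
    define g where "g = g0 - c *\<^sub>R \<theta>"
    have "((\<lambda>y. \<theta> \<bullet> y) has_derivative (\<lambda>h. \<theta> \<bullet> h)) (at \<theta> within S2)"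
      by (auto intro!: derivative_eq_intros)
    then have "((\<lambda>y. u y - c *\<^sub>R (\<theta> \<bullet> y) + c *\<^sub>R (\<theta> \<bullet> y)) has_derivative
        (\<lambda>h. D h - c *\<^sub>R (\<theta> \<bullet> h) + c *\<^sub>R 0)) (at \<theta> within S2)"
      by (intro has_derivative_add has_derivative_diff has_derivative_scaleR_right D
          height_has_derivative_zero[OF \<theta>])
    moreover have "(\<lambda>h. D h - c *\<^sub>R (\<theta> \<bullet> h) + c *\<^sub>R 0) = (\<lambda>h. g \<bullet> h)"
      by (auto simp: g_def D_eq inner_diff_left)
    ultimately have "?P g" using tt by (simp add: g_def c_def inner_diff_left)
    then show "\<exists>g. ?P g" by blast
  next
    fix g g' assume g: "?P g" and g': "?P g'"
    show "g = g'"
    proof (rule ccontr)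
      assume "g \<noteq> g'"
      define w where "w = g - g'"
      have w: "w \<noteq> 0" "w \<bullet> \<theta> = 0" using \<open>g \<noteq> g'\<close> g g' by (auto simp: w_def inner_diff_left)
      define e where "e = (1 / norm w) *\<^sub>R w"
      have e: "e \<in> S2" "e \<bullet> \<theta> = 0" using w by (auto simp: e_def)
      define \<gamma> where "\<gamma> = (\<lambda>t. cos t *\<^sub>R \<theta> + sin t *\<^sub>R e)"
      have "((\<lambda>y. u y - u y) has_derivative (\<lambda>h. g \<bullet> h - g' \<bullet> h)) (at \<theta> within S2)"
        using g g' by (intro has_derivative_diff) auto
      then have "((\<lambda>y. 0) has_derivative (\<lambda>h. w \<bullet> h)) (at \<theta> within S2)"
        by (simp add: w_def inner_diff_left)
      then have "((\<lambda>y. 0) has_derivative (\<lambda>h. w \<bullet> h)) (at (\<gamma> 0) within range \<gamma>)"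
      proof -
        have "\<gamma> 0 = \<theta>" by (simp add: \<gamma>_def)
        moreover have "range \<gamma> \<subseteq> S2" using tangent_curve(1)[OF \<theta> e] unfolding \<gamma>_def by blast
        ultimately show ?thesis
          using has_derivative_subset[OF \<open>((\<lambda>y. 0) has_derivative (\<lambda>h. w \<bullet> h)) (at \<theta> within S2)\<close>] by simp
      qed
      moreover have "(\<gamma> has_vector_derivative e) (at 0)"
        using tangent_curve(2)[OF \<theta> e, of 0 UNIV] by (simp add: \<gamma>_def)
      ultimately have "((\<lambda>y. 0) \<circ> \<gamma> has_vector_derivative w \<bullet> e) (at 0)"
        by (intro vector_derivative_diff_chain_within)
      then have "((\<lambda>t::real. 0) has_real_derivative w \<bullet> e) (at 0)"
        by (simp add: o_def has_real_derivative_iff_has_vector_derivative)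
      then have "w \<bullet> e = 0" using DERIV_unique DERIV_const by blast
      then show False using w by (simp add: e_def)
    qed
  qed
  from theI'[OF this] show "sphere_grad u \<theta> \<bullet> \<theta> = 0"
    and "(u has_derivative (\<lambda>h. sphere_grad u \<theta> \<bullet> h)) (at \<theta> within S2)"
    unfolding sphere_grad_def by auto
qed

text \<open>
  The divergence is a trace over the tangent plane and can be computed in any orthonormal basis.
\<close>
lemma laplace_beltrami_frame:
  assumes \<theta>: "\<theta> \<in> S2"
    and D: "D = frechet_derivative (sphere_grad u) (at \<theta> within S2)" "linear D"
    and e: "e1 \<bullet> e1 = 1" "e2 \<bullet> e2 = 1" "e1 \<bullet> e2 = 0" "e1 \<bullet> \<theta> = 0" "e2 \<bullet> \<theta> = 0"
  shows "laplace_beltrami u \<theta> = D e1 \<bullet> e1 + D e2 \<bullet> e2"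
proof -
  have tp: "tangent_proj \<theta> x = (x \<bullet> e1) *\<^sub>R e1 + (x \<bullet> e2) *\<^sub>R e2" for x
  proof -
    have "x = (x \<bullet> e1) *\<^sub>R e1 + (x \<bullet> e2) *\<^sub>R e2 + (x \<bullet> \<theta>) *\<^sub>R \<theta>"
      using e S2_inner_self[OF \<theta>] by (intro orthonormal_expansion)
    then show ?thesis by (simp add: tangent_proj_def algebra_simps)
  qed
  have "laplace_beltrami u \<theta> = (\<Sum>b\<in>Basis. D (tangent_proj \<theta> b) \<bullet> b)"
    by (simp add: laplace_beltrami_def sphere_div_def sphere_deriv_def D)
  also have "\<dots> = (\<Sum>b\<in>Basis. (D e1 \<bullet> b) * (e1 \<bullet> b) + (D e2 \<bullet> b) * (e2 \<bullet> b))"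
    unfolding tp using D(2)
    by (intro sum.cong refl) (simp add: linear_add linear_cmul inner_add_left inner_commute[of e1] inner_commute[of e2] mult.commute)
  also have "\<dots> = D e1 \<bullet> e1 + D e2 \<bullet> e2"
    by (simp add: sum.distrib euclidean_inner[of "D e1" e1] euclidean_inner[of "D e2" e2])
  finally show ?thesis .
qed

text \<open>
  The second term vanishes for geodesics; for coordinate lines of a conformal chart it cancels only
  in the sum over both directions.
\<close>
lemma second_derivative_along_curve:
  assumes "open S" "t \<in> S" and \<gamma>: "range \<gamma> \<subseteq> S2"
    and d1: "\<And>s. (\<gamma> has_vector_derivative \<gamma>' s) (at s)"
    and d2: "(\<gamma>' has_vector_derivative c) (at t)"
    and u: "\<And>s. s \<in> S \<Longrightarrow> u differentiable (at (\<gamma> s) within S2)"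
    and D: "(sphere_grad u has_derivative D) (at (\<gamma> t) within S2)"
  shows "has_second_derivative (\<lambda>s. u (\<gamma> s)) (D (\<gamma>' t) \<bullet> \<gamma>' t + sphere_grad u (\<gamma> t) \<bullet> c) t"
proof (rule has_second_derivativeI[OF assms(1,2)])
  show "((\<lambda>s. u (\<gamma> s)) has_real_derivative sphere_grad u (\<gamma> s) \<bullet> \<gamma>' s) (at s)" if "s \<in> S" for s
  proof -
    have "\<gamma> s \<in> S2" using \<gamma> by blast
    then have "(u has_derivative (\<lambda>h. sphere_grad u (\<gamma> s) \<bullet> h)) (at (\<gamma> s) within range \<gamma>)"
      using sphere_grad_works(2) u[OF that] \<gamma> has_derivative_subset by blast
    from vector_derivative_diff_chain_within[OF d1 this]
    show ?thesis by (simp add: o_def has_real_derivative_iff_has_vector_derivative)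
  qed
  have "((\<lambda>s. sphere_grad u (\<gamma> s)) has_vector_derivative D (\<gamma>' t)) (at t)"
    using vector_derivative_diff_chain_within[OF d1 has_derivative_subset[OF D \<gamma>]] by (simp add: o_def)
  from has_derivative_inner[OF this[unfolded has_vector_derivative_def] d2[unfolded has_vector_derivative_def]]
  show "((\<lambda>s. sphere_grad u (\<gamma> s) \<bullet> \<gamma>' s) has_real_derivative
      D (\<gamma>' t) \<bullet> \<gamma>' t + sphere_grad u (\<gamma> t) \<bullet> c) (at t)"
    unfolding has_field_derivative_def
    by (rule has_derivative_eq_rhs) (auto simp: algebra_simps)
qed

section \<open>Stereographic projection\<close>

text \<open>
  Stereographic projection from the south pole, with the horizontal plane spanned by an arbitrary
  orthonormal pair. Since every direction can serve as first coordinate axis, the planar result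
  for one family of parallel lines yields all vertical planes of symmetry.
\<close>
locale horizontal_frame =
  fixes a b :: "real^3"
  assumes frame: "a \<bullet> a = 1" "b \<bullet> b = 1" "a \<bullet> b = 0" "a \<bullet> north = 0" "b \<bullet> north = 0"
begin

lemma frame': "b \<bullet> a = 0" "north \<bullet> a = 0" "north \<bullet> b = 0" "north \<bullet> north = 1"
  using frame north_sphere(1) by (simp_all add: inner_commute)

definition factor :: "real \<times> real \<Rightarrow> real"
  where "factor p = 2 / (1 + (norm p)\<^sup>2)"

definition lift :: "real \<times> real \<Rightarrow> real^3"
  where "lift p = fst p *\<^sub>R a + snd p *\<^sub>R b + north"

definition stereo :: "real \<times> real \<Rightarrow> real^3"
  where "stereo p = factor p *\<^sub>R lift p - north"

lemma factor_pos: "factor p > 0"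
  by (simp add: factor_def add_pos_nonneg)

lemma factor_eq: "factor p * (1 + (norm p)\<^sup>2) = 2"
proof -
  have "1 + (norm p)\<^sup>2 \<noteq> 0" using zero_le_power2[of "norm p"] by linarith
  then show ?thesis unfolding factor_def by (rule nonzero_eq_divide_eq[THEN iffD1]) simp
qed

lemma lift_inner: "lift p \<bullet> a = fst p" "lift p \<bullet> b = snd p" "lift p \<bullet> north = 1"
  "a \<bullet> lift p = fst p" "b \<bullet> lift p = snd p" "north \<bullet> lift p = 1"
  "lift p \<bullet> lift p = 1 + (norm p)\<^sup>2"
  unfolding norm_prod_sq using frame frame' by (auto simp: lift_def inner_add power2_eq_square)

lemma stereo_sphere: "stereo p \<in> S2"
proof -
  have "stereo p \<bullet> stereo p = factor p * (factor p * (1 + (norm p)\<^sup>2)) - 2 * factor p + 1"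
    using frame frame' by (simp add: stereo_def inner_diff lift_inner algebra_simps)
  then show ?thesis unfolding in_S2 factor_eq by simp
qed

lemma stereo_height: "stereo p \<bullet> north = factor p - 1"
  using frame' by (simp add: stereo_def inner_diff lift_inner)

lemma stereo_eq_north: "stereo p = north \<longleftrightarrow> p = 0"
proof
  assume "stereo p = north"
  then have "factor p = 2" using stereo_height[of p] north_sphere(1) by simp
  then have "(norm p)\<^sup>2 = 0" using factor_eq[of p] by simp
  then show "p = 0" by simp
next
  assume "p = 0"
  then show "stereo p = north" by (simp add: stereo_def factor_def lift_def algebra_simps scaleR_2)
qed

lemma factor_has_derivative:
  "((\<lambda>t. factor (t, y)) has_real_derivative - t * (factor (t, y))\<^sup>2) (at t)"
  "((\<lambda>t. factor (x, t)) has_real_derivative - t * (factor (x, t))\<^sup>2) (at t)"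
proof -
  have D: "((\<lambda>t. 2 / (t\<^sup>2 + (1 + y\<^sup>2))) has_real_derivative - t * (2 / (t\<^sup>2 + (1 + y\<^sup>2)))\<^sup>2) (at t)" for t y :: real
  proof -
    have "t\<^sup>2 + (1 + y\<^sup>2) > 0" by (simp add: add_nonneg_pos add_pos_nonneg)
    then show ?thesis
      by (auto intro!: derivative_eq_intros simp: power_divide power2_eq_square[of "_ + _"])
  qed
  show "((\<lambda>t. factor (t, y)) has_real_derivative - t * (factor (t, y))\<^sup>2) (at t)"
    using D[of y t] by (simp add: factor_def norm_prod_sq ac_simps)
  show "((\<lambda>t. factor (x, t)) has_real_derivative - t * (factor (x, t))\<^sup>2) (at t)"
    using D[of x t] by (simp add: factor_def norm_prod_sq ac_simps)
qed

definition stereo_fst :: "real \<times> real \<Rightarrow> real^3"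
  where "stereo_fst p = factor p *\<^sub>R a - (fst p * (factor p)\<^sup>2) *\<^sub>R lift p"

definition stereo_snd :: "real \<times> real \<Rightarrow> real^3"
  where "stereo_snd p = factor p *\<^sub>R b - (snd p * (factor p)\<^sup>2) *\<^sub>R lift p"

lemma lift_has_vector_derivative:
  "((\<lambda>t. lift (t, y)) has_vector_derivative a) (at t)"
  "((\<lambda>t. lift (x, t)) has_vector_derivative b) (at t)"
  unfolding lift_def has_vector_derivative_def by (auto intro!: derivative_eq_intros)

lemma stereo_has_vector_derivative:
  "((\<lambda>t. stereo (t, y)) has_vector_derivative stereo_fst (t, y)) (at t)"
  "((\<lambda>t. stereo (x, t)) has_vector_derivative stereo_snd (x, t)) (at t)"
proof -
  have "((\<lambda>t. factor (t, y) *\<^sub>R lift (t, y) - north) has_vector_derivative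
     factor (t, y) *\<^sub>R a + (- t * (factor (t, y))\<^sup>2) *\<^sub>R lift (t, y) - 0) (at t)"
    by (intro has_vector_derivative_diff has_vector_derivative_scaleR lift_has_vector_derivative
      factor_has_derivative has_vector_derivative_const)
  then show "((\<lambda>t. stereo (t, y)) has_vector_derivative stereo_fst (t, y)) (at t)"
    by (simp add: stereo_def stereo_fst_def)
  have "((\<lambda>t. factor (x, t) *\<^sub>R lift (x, t) - north) has_vector_derivative
     factor (x, t) *\<^sub>R b + (- t * (factor (x, t))\<^sup>2) *\<^sub>R lift (x, t) - 0) (at t)"
    by (intro has_vector_derivative_diff has_vector_derivative_scaleR lift_has_vector_derivative
      factor_has_derivative has_vector_derivative_const)
  then show "((\<lambda>t. stereo (x, t)) has_vector_derivative stereo_snd (x, t)) (at t)"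
    by (simp add: stereo_def stereo_snd_def)
qed

definition stereo_fst2 :: "real \<times> real \<Rightarrow> real^3"
  where "stereo_fst2 p = - (2 * fst p * (factor p)\<^sup>2) *\<^sub>R a
    + (2 * (fst p)\<^sup>2 * factor p ^ 3 - (factor p)\<^sup>2) *\<^sub>R lift p"

definition stereo_snd2 :: "real \<times> real \<Rightarrow> real^3"
  where "stereo_snd2 p = - (2 * snd p * (factor p)\<^sup>2) *\<^sub>R b
    + (2 * (snd p)\<^sup>2 * factor p ^ 3 - (factor p)\<^sup>2) *\<^sub>R lift p"

lemma stereo_has_second_derivative:
  "((\<lambda>t. stereo_fst (t, y)) has_vector_derivative stereo_fst2 (t, y)) (at t)"
  "((\<lambda>t. stereo_snd (x, t)) has_vector_derivative stereo_snd2 (x, t)) (at t)"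
proof -
  let ?s = "factor (t, y)"
  have "((\<lambda>t. t * (factor (t, y))\<^sup>2) has_real_derivative
      1 * ?s\<^sup>2 + (real 2 * (- t * ?s\<^sup>2 * ?s ^ (2 - Suc 0))) * t) (at t)"
    by (intro DERIV_mult DERIV_ident DERIV_power factor_has_derivative)
  then have "((\<lambda>t. t * (factor (t, y))\<^sup>2) has_real_derivative ?s\<^sup>2 - 2 * t\<^sup>2 * ?s ^ 3) (at t)"
    by (simp add: eval_nat_numeral algebra_simps)
  then have "((\<lambda>t. factor (t, y) *\<^sub>R a - (t * (factor (t, y))\<^sup>2) *\<^sub>R lift (t, y)) has_vector_derivative
     (?s *\<^sub>R 0 + (- t * ?s\<^sup>2) *\<^sub>R a) -
     ((t * ?s\<^sup>2) *\<^sub>R a + (?s\<^sup>2 - 2 * t\<^sup>2 * ?s ^ 3) *\<^sub>R lift (t, y))) (at t)"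
    by (intro has_vector_derivative_diff has_vector_derivative_scaleR lift_has_vector_derivative
      factor_has_derivative has_vector_derivative_const)
  then show "((\<lambda>t. stereo_fst (t, y)) has_vector_derivative stereo_fst2 (t, y)) (at t)"
    unfolding stereo_fst_def stereo_fst2_def fst_conv
    by (rule has_vector_derivative_eq_rhs) (simp add: vec_eq_iff algebra_simps)
next
  let ?s = "factor (x, t)"
  have "((\<lambda>t. t * (factor (x, t))\<^sup>2) has_real_derivative
      1 * ?s\<^sup>2 + (real 2 * (- t * ?s\<^sup>2 * ?s ^ (2 - Suc 0))) * t) (at t)"
    by (intro DERIV_mult DERIV_ident DERIV_power factor_has_derivative)
  then have "((\<lambda>t. t * (factor (x, t))\<^sup>2) has_real_derivative ?s\<^sup>2 - 2 * t\<^sup>2 * ?s ^ 3) (at t)"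
    by (simp add: eval_nat_numeral algebra_simps)
  then have "((\<lambda>t. factor (x, t) *\<^sub>R b - (t * (factor (x, t))\<^sup>2) *\<^sub>R lift (x, t)) has_vector_derivative
     (?s *\<^sub>R 0 + (- t * ?s\<^sup>2) *\<^sub>R b) -
     ((t * ?s\<^sup>2) *\<^sub>R b + (?s\<^sup>2 - 2 * t\<^sup>2 * ?s ^ 3) *\<^sub>R lift (x, t))) (at t)"
    by (intro has_vector_derivative_diff has_vector_derivative_scaleR lift_has_vector_derivative
      factor_has_derivative has_vector_derivative_const)
  then show "((\<lambda>t. stereo_snd (x, t)) has_vector_derivative stereo_snd2 (x, t)) (at t)"
    unfolding stereo_snd_def stereo_snd2_def snd_conv
    by (rule has_vector_derivative_eq_rhs) (simp add: vec_eq_iff algebra_simps)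
qed

text \<open>
  The chart is conformal with metric \<open>(factor p)\<^sup>2 |dx|\<^sup>2\<close>.
\<close>
lemma stereo_conformal:
  "stereo_fst p \<bullet> stereo_fst p = (factor p)\<^sup>2" "stereo_snd p \<bullet> stereo_snd p = (factor p)\<^sup>2"
  "stereo_fst p \<bullet> stereo_snd p = 0" "stereo_fst p \<bullet> stereo p = 0" "stereo_snd p \<bullet> stereo p = 0"
proof -
  let ?s = "factor p" and ?q = "1 + (norm p)\<^sup>2"
  have 1: "stereo_fst p \<bullet> stereo_fst p = ?s\<^sup>2 + (fst p)\<^sup>2 * ?s ^ 3 * (?s * ?q - 2)"
    using frame frame' by (simp add: stereo_fst_def inner_diff lift_inner eval_nat_numeral algebra_simps)
  have 2: "stereo_snd p \<bullet> stereo_snd p = ?s\<^sup>2 + (snd p)\<^sup>2 * ?s ^ 3 * (?s * ?q - 2)"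
    using frame frame' by (simp add: stereo_snd_def inner_diff lift_inner eval_nat_numeral algebra_simps)
  have 3: "stereo_fst p \<bullet> stereo_snd p = fst p * snd p * ?s ^ 3 * (?s * ?q - 2)"
    using frame frame' by (simp add: stereo_fst_def stereo_snd_def inner_diff lift_inner eval_nat_numeral algebra_simps)
  have 4: "stereo_fst p \<bullet> stereo p = fst p * ?s\<^sup>2 * (2 - ?s * ?q)"
    using frame frame' by (simp add: stereo_fst_def stereo_def inner_diff lift_inner eval_nat_numeral algebra_simps)
  have 5: "stereo_snd p \<bullet> stereo p = snd p * ?s\<^sup>2 * (2 - ?s * ?q)"
    using frame frame' by (simp add: stereo_snd_def stereo_def inner_diff lift_inner eval_nat_numeral algebra_simps)
  show "stereo_fst p \<bullet> stereo_fst p = (factor p)\<^sup>2" "stereo_snd p \<bullet> stereo_snd p = (factor p)\<^sup>2"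
    "stereo_fst p \<bullet> stereo_snd p = 0" "stereo_fst p \<bullet> stereo p = 0" "stereo_snd p \<bullet> stereo p = 0"
    unfolding 1 2 3 4 5 factor_eq by simp_all
qed

text \<open>
  A conformal chart of the sphere is a harmonic map, so its ambient Laplacian is normal to the
  sphere.
\<close>
lemma stereo_harmonic: "stereo_fst2 p + stereo_snd2 p = - (2 * (factor p)\<^sup>2) *\<^sub>R stereo p"
proof -
  let ?s = "factor p"
  have "stereo_fst2 p + stereo_snd2 p =
     - (2 * ?s\<^sup>2) *\<^sub>R (fst p *\<^sub>R a + snd p *\<^sub>R b) + (2 * ((norm p)\<^sup>2 * ?s) * ?s\<^sup>2 - 2 * ?s\<^sup>2) *\<^sub>R lift p"
    unfolding norm_prod_sq stereo_fst2_def stereo_snd2_def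
    by (simp add: vec_eq_iff eval_nat_numeral algebra_simps)
  also have "(norm p)\<^sup>2 * ?s = 2 - ?s" using factor_eq[of p] by (simp add: algebra_simps)
  also have "fst p *\<^sub>R a + snd p *\<^sub>R b = lift p - north" by (simp add: lift_def)
  also have "- (2 * ?s\<^sup>2) *\<^sub>R (lift p - north) + (2 * (2 - ?s) * ?s\<^sup>2 - 2 * ?s\<^sup>2) *\<^sub>R lift p =
     - (2 * ?s\<^sup>2) *\<^sub>R stereo p"
    by (simp add: stereo_def vec_eq_iff eval_nat_numeral algebra_simps)
  finally show ?thesis .
qed

text \<open>
  Conformal invariance of the Laplacian in dimension two. The first derivatives of the chart, being
  orthogonal of length \<open>factor p\<close>, turn the Hessian trace into the Laplace-Beltrami operator, and the
  second derivatives drop out because the gradient is tangent.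
\<close>
lemma stereo_laplacian:
  assumes u: "\<And>\<theta>. \<theta> \<in> S2 - {north} \<Longrightarrow> u differentiable (at \<theta> within S2)"
    and du: "sphere_grad u differentiable (at (stereo p) within S2)" and p: "p \<noteq> 0"
  shows "has_laplacian (\<lambda>q. u (stereo q)) ((factor p)\<^sup>2 * laplace_beltrami u (stereo p)) p"
proof (rule has_laplacianI)
  define D where "D = frechet_derivative (sphere_grad u) (at (stereo p) within S2)"
  have D: "(sphere_grad u has_derivative D) (at (stereo p) within S2)"
    using du unfolding D_def frechet_derivative_works .
  have linD: "linear D" using D by (rule has_derivative_linear)
  let ?G = "sphere_grad u (stereo p)" and ?s = "factor p"
  have udiff: "u differentiable (at (stereo q) within S2)" if "q \<noteq> 0" for q
    using u[of "stereo q"] stereo_sphere[of q] stereo_eq_north[of q] that by simp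
  have op1: "open {t::real. (t, snd p) \<noteq> 0}" by (intro open_Collect_neq continuous_intros)
  have op2: "open {t::real. (fst p, t) \<noteq> 0}" by (intro open_Collect_neq continuous_intros)
  have "has_second_derivative (\<lambda>t. u (stereo (t, snd p)))
     (D (stereo_fst (fst p, snd p)) \<bullet> stereo_fst (fst p, snd p) +
      sphere_grad u (stereo (fst p, snd p)) \<bullet> stereo_fst2 (fst p, snd p)) (fst p)"
    using p stereo_sphere D udiff
    by (intro second_derivative_along_curve[OF op1] stereo_has_vector_derivative
        stereo_has_second_derivative) auto
  then show "has_second_derivative (\<lambda>t. u (stereo (t, snd p)))
     (D (stereo_fst p) \<bullet> stereo_fst p + ?G \<bullet> stereo_fst2 p) (fst p)" by simp
  have "has_second_derivative (\<lambda>t. u (stereo (fst p, t)))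
     (D (stereo_snd (fst p, snd p)) \<bullet> stereo_snd (fst p, snd p) +
      sphere_grad u (stereo (fst p, snd p)) \<bullet> stereo_snd2 (fst p, snd p)) (snd p)"
    using p stereo_sphere D udiff
    by (intro second_derivative_along_curve[OF op2] stereo_has_vector_derivative
        stereo_has_second_derivative) auto
  then show "has_second_derivative (\<lambda>t. u (stereo (fst p, t)))
     (D (stereo_snd p) \<bullet> stereo_snd p + ?G \<bullet> stereo_snd2 p) (snd p)" by simp
  have s: "?s > 0" by (rule factor_pos)
  let ?e1 = "(1 / ?s) *\<^sub>R stereo_fst p" and ?e2 = "(1 / ?s) *\<^sub>R stereo_snd p"
  have "laplace_beltrami u (stereo p) = D ?e1 \<bullet> ?e1 + D ?e2 \<bullet> ?e2"
    using s by (intro laplace_beltrami_frame stereo_sphere D_def linD)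
      (auto simp: stereo_conformal power2_eq_square)
  also have "\<dots> = (D (stereo_fst p) \<bullet> stereo_fst p + D (stereo_snd p) \<bullet> stereo_snd p) / ?s\<^sup>2"
    by (simp add: linear_cmul[OF linD] power2_eq_square add_divide_distrib)
  finally have 1: "?s\<^sup>2 * laplace_beltrami u (stereo p) =
      D (stereo_fst p) \<bullet> stereo_fst p + D (stereo_snd p) \<bullet> stereo_snd p" using s by simp
  have "?G \<bullet> stereo p = 0"
    by (rule sphere_grad_works(1)[OF stereo_sphere udiff[OF p]])
  then have "?G \<bullet> stereo_fst2 p + ?G \<bullet> stereo_snd2 p = 0"
    by (simp add: stereo_harmonic flip: inner_add_right)
  with 1 show "?s\<^sup>2 * laplace_beltrami u (stereo p) =
    (D (stereo_fst p) \<bullet> stereo_fst p + ?G \<bullet> stereo_fst2 p) +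
    (D (stereo_snd p) \<bullet> stereo_snd p + ?G \<bullet> stereo_snd2 p)" by simp
qed

end

section \<open>Points of the sphere by height and the distance to the pole\<close>

lemma norm_sub_north:
  assumes "\<theta> \<in> S2"
  shows "(norm (\<theta> - north))\<^sup>2 = 2 - 2 * (\<theta> \<bullet> north)"
  using S2_inner_self[OF assms] north_sphere(1)
  by (simp add: power2_norm_eq_inner inner_diff inner_commute)

lemma height_bounds:
  assumes "\<theta> \<in> S2"
  shows "- 1 \<le> \<theta> \<bullet> north" "\<theta> \<bullet> north \<le> 1"
    and "\<theta> \<bullet> north = 1 \<Longrightarrow> \<theta> = north" "\<theta> \<bullet> north = - 1 \<Longrightarrow> \<theta> = south"
proof -
  have "(\<theta> + north) \<bullet> (\<theta> + north) = 2 + 2 * (\<theta> \<bullet> north)"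
    using S2_inner_self[OF assms] north_sphere(1) by (simp add: inner_add inner_commute)
  moreover have "(\<theta> - north) \<bullet> (\<theta> - north) = 2 - 2 * (\<theta> \<bullet> north)"
    using S2_inner_self[OF assms] north_sphere(1) by (simp add: inner_diff inner_commute)
  moreover have "(\<theta> + north) \<bullet> (\<theta> + north) \<ge> 0" "(\<theta> - north) \<bullet> (\<theta> - north) \<ge> 0" by simp_all
  moreover have "(\<theta> + north) \<bullet> (\<theta> + north) = 0 \<Longrightarrow> \<theta> = south"
    unfolding inner_eq_zero_iff north_sphere(3) by (rule eq_neg_iff_add_eq_0[THEN iffD2])
  moreover have "(\<theta> - north) \<bullet> (\<theta> - north) = 0 \<Longrightarrow> \<theta> = north" by simp
  ultimately show "- 1 \<le> \<theta> \<bullet> north" "\<theta> \<bullet> north \<le> 1"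
    and "\<theta> \<bullet> north = 1 \<Longrightarrow> \<theta> = north" "\<theta> \<bullet> north = - 1 \<Longrightarrow> \<theta> = south"
    by linarith+
qed

lemma meridian_point:
  assumes "\<theta> \<in> S2" "\<theta> \<noteq> north" "\<theta> \<noteq> south"
  obtains e where "e \<in> S2" "e \<bullet> north = 0"
    "\<theta> = (\<theta> \<bullet> north) *\<^sub>R north + sqrt (1 - (\<theta> \<bullet> north)\<^sup>2) *\<^sub>R e" "\<bar>\<theta> \<bullet> north\<bar> < 1"
proof -
  define c where "c = \<theta> \<bullet> north"
  define w where "w = \<theta> - c *\<^sub>R north"
  have c: "\<bar>c\<bar> < 1" using height_bounds[OF assms(1)] assms(2,3) unfolding c_def by fastforce
  then have pos: "1 - c\<^sup>2 > 0" by (simp add: abs_square_less_1)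
  have "w \<bullet> w = 1 - c\<^sup>2"
    using S2_inner_self[OF assms(1)] north_sphere(1)
    by (simp add: w_def inner_diff inner_commute[of north \<theta>] power2_eq_square flip: c_def)
  then have nw: "norm w = sqrt (1 - c\<^sup>2)" by (simp add: norm_eq_sqrt_inner)
  show thesis
  proof
    show "(1 / norm w) *\<^sub>R w \<in> S2" using nw pos by simp
    show "(1 / norm w) *\<^sub>R w \<bullet> north = 0" using north_sphere(1) by (simp add: w_def inner_diff c_def)
    show "\<theta> = (\<theta> \<bullet> north) *\<^sub>R north + sqrt (1 - (\<theta> \<bullet> north)\<^sup>2) *\<^sub>R (1 / norm w) *\<^sub>R w"
      using nw pos by (simp add: w_def c_def)
    show "\<bar>\<theta> \<bullet> north\<bar> < 1" using c by (simp add: c_def)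
  qed
qed

lemma path_length_ge_chord:
  fixes g :: "real \<Rightarrow> 'a::euclidean_space"
  assumes "valid_path g"
    and L: "((\<lambda>t. norm (vector_derivative g (at t within {0..1}))) has_integral L) {0..1}"
  shows "norm (pathstart g - pathfinish g) \<le> L"
proof -
  let ?d = "\<lambda>t. vector_derivative g (at t within {0..1})"
  obtain S where S: "finite S" "g C1_differentiable_on {0..1} - S" and cont: "continuous_on {0..1} g"
    using assms(1) by (auto simp: valid_path_def piecewise_C1_differentiable_on_def)
  have "(?d has_integral (g 1 - g 0)) {0..1}"
  proof (rule fundamental_theorem_of_calculus_interior_strong[OF S(1) _ _ cont])
    fix t :: real assume t: "t \<in> {0<..<1} - S"
    then obtain D where "(g has_vector_derivative D) (at t)"
      using S(2) unfolding C1_differentiable_on_def by fastforce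
    moreover from this have "?d t = D"
      using t by (intro vector_derivative_at_within_ivl) auto
    ultimately show "(g has_vector_derivative ?d t) (at t)" by simp
  qed simp
  then have "norm (g 1 - g 0) \<le> L"
    using integral_norm_bound_integral[of ?d "{0..1}" "\<lambda>t. norm (?d t)"] L
    by (auto simp: integral_unique has_integral_integrable)
  then show ?thesis by (simp add: pathstart_def pathfinish_def norm_minus_commute)
qed

text \<open>
  A path is at least as long as its chord, and the meridian through \<open>\<theta>\<close> is one competitor. These
  crude bounds suffice because the distance enters the hypothesis only through its logarithm.
\<close>
lemma geodesic_dist_north_bounds:
  assumes \<theta>: "\<theta> \<in> S2" "\<theta> \<noteq> north" "\<theta> \<noteq> south"
  shows "norm (\<theta> - north) \<le> geodesic_dist \<theta> north" "geodesic_dist \<theta> north \<le> arccos (\<theta> \<bullet> north)"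
proof -
  let ?A = "{L. \<exists>g. valid_path g \<and> path_image g \<subseteq> S2 \<and> pathstart g = \<theta> \<and> pathfinish g = north \<and>
            ((\<lambda>t. norm (vector_derivative g (at t within {0..1}))) has_integral L) {0..1}}"
  define c where "c = \<theta> \<bullet> north"
  obtain e where e: "e \<in> S2" "e \<bullet> north = 0" "\<theta> = c *\<^sub>R north + sqrt (1 - c\<^sup>2) *\<^sub>R e" "\<bar>c\<bar> < 1"
    using meridian_point[OF assms] unfolding c_def by metis
  define \<alpha> where "\<alpha> = arccos c"
  have \<alpha>: "cos \<alpha> = c" "sin \<alpha> = sqrt (1 - c\<^sup>2)" "\<alpha> \<ge> 0"
    using e(4) by (auto simp: \<alpha>_def cos_arccos_abs sin_arccos_abs arccos_lbound)
  define arc where "arc = (\<lambda>t. cos t *\<^sub>R north + sin t *\<^sub>R e)"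
  define arc' where "arc' = (\<lambda>t. - sin t *\<^sub>R north + cos t *\<^sub>R e)"
  define g where "g = (\<lambda>t. arc ((1 - t) * \<alpha>))"
  have arcS: "arc t \<in> S2" for t
    unfolding arc_def by (rule tangent_curve(1)[OF north_sphere(2) e(1,2)])
  have "(arc has_vector_derivative arc' t) (at t)" for t
    unfolding arc_def arc'_def by (rule tangent_curve(2)[OF north_sphere(2) e(1,2)])
  then have dg: "(g has_vector_derivative (- \<alpha>) *\<^sub>R arc' ((1 - t) * \<alpha>)) (at t)" for t
  proof -
    have "((\<lambda>t. (1 - t) * \<alpha>) has_real_derivative - \<alpha>) (at t)"
      by (auto intro!: derivative_eq_intros)
    then show ?thesis unfolding g_def has_real_derivative_iff_has_vector_derivative
      using vector_diff_chain_at[of "\<lambda>t. (1 - t) * \<alpha>" "- \<alpha>" t arc "arc' ((1 - t) * \<alpha>)"]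
        \<open>\<And>t. (arc has_vector_derivative arc' t) (at t)\<close> by (simp add: o_def)
  qed
  have na: "norm (arc' t) = 1" for t
  proof -
    have "arc' t \<bullet> arc' t = (sin t)\<^sup>2 * (north \<bullet> north) + (cos t)\<^sup>2 * (e \<bullet> e)"
      using e(2) by (simp add: arc'_def inner_add inner_diff inner_commute[of north e] power2_eq_square)
    then show ?thesis using north_sphere(1) S2_inner_self[OF e(1)] by (simp add: norm_eq_1)
  qed
  have "continuous_on {0..1} (\<lambda>t. (- \<alpha>) *\<^sub>R arc' ((1 - t) * \<alpha>))"
    unfolding arc'_def by (intro continuous_intros)
  then have "g C1_differentiable_on {0..1}"
    unfolding C1_differentiable_on_def
    using dg by (intro exI[of _ "\<lambda>t. (- \<alpha>) *\<^sub>R arc' ((1 - t) * \<alpha>)"]) auto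
  then have vp: "valid_path g" unfolding valid_path_def by (rule C1_differentiable_imp_piecewise)
  have "norm (vector_derivative g (at t within {0..1})) = \<alpha>" if "t \<in> {0..1}" for t
    using vector_derivative_at_within_ivl[OF dg, of 0 t 1] that na \<alpha>(3) by simp
  then have "((\<lambda>t. norm (vector_derivative g (at t within {0..1}))) has_integral \<alpha>) {0..1}"
    using has_integral_const_real[of \<alpha> 0 1] by (subst has_integral_cong[where g = "\<lambda>_. \<alpha>"]) auto
  moreover have "pathstart g = \<theta>" "pathfinish g = north" "path_image g \<subseteq> S2"
    using e(3) \<alpha> arcS by (auto simp: pathstart_def pathfinish_def path_image_def g_def arc_def)
  ultimately have mem: "\<alpha> \<in> ?A" using vp by blast
  have lower: "norm (\<theta> - north) \<le> L" if L: "L \<in> ?A" for L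
  proof -
    obtain g where g: "valid_path g \<and> path_image g \<subseteq> S2 \<and> pathstart g = \<theta> \<and> pathfinish g = north \<and>
        ((\<lambda>t. norm (vector_derivative g (at t within {0..1}))) has_integral L) {0..1}"
      using L unfolding mem_Collect_eq ..
    then have "norm (pathstart g - pathfinish g) \<le> L" by (intro path_length_ge_chord) simp_all
    then show ?thesis using g by simp
  qed
  show "norm (\<theta> - north) \<le> geodesic_dist \<theta> north"
    unfolding geodesic_dist_def using mem lower by (intro cInf_greatest) blast+
  have "bdd_below ?A" using lower by (rule bdd_belowI)
  then show "geodesic_dist \<theta> north \<le> arccos (\<theta> \<bullet> north)"
    unfolding geodesic_dist_def using cInf_lower[OF mem] by (simp add: \<alpha>_def c_def)
qed

text \<open>
  Close to the pole the logarithm of the distance is negative, so the upper limit of the quotient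
  bounds \<open>v\<close> from below.
\<close>
lemma log_lower_bound:
  assumes lim: "Limsup (at north within S2) (\<lambda>\<theta>. ereal (v \<theta> / ln (geodesic_dist \<theta> north))) \<le> 0"
    and \<epsilon>: "\<epsilon> > 0"
  shows "\<exists>\<delta>>0. \<forall>\<theta>\<in>S2. \<theta> \<noteq> north \<longrightarrow> norm (\<theta> - north) < \<delta> \<longrightarrow> \<epsilon> * ln (norm (\<theta> - north)) \<le> v \<theta>"
proof -
  have "\<forall>\<^sub>F \<theta> in at north within S2. ereal (v \<theta> / ln (geodesic_dist \<theta> north)) < ereal \<epsilon>"
    using lim \<epsilon> by (intro Limsup_lessD) (metis ereal_less(2) le_less_trans)
  then obtain \<delta>0 where \<delta>0: "\<delta>0 > 0" "\<And>\<theta>. \<theta> \<in> S2 \<Longrightarrow> \<theta> \<noteq> north \<Longrightarrow> norm (\<theta> - north) < \<delta>0 \<Longrightarrow>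
      v \<theta> / ln (geodesic_dist \<theta> north) < \<epsilon>"
    unfolding eventually_at by (auto simp: dist_norm)
  define \<delta> where "\<delta> = min \<delta>0 (sqrt (2 - 2 * cos 1))"
  have cos1: "cos (1::real) < 1" using cos_monotone_0_pi[of 0 1] pi_gt3 by simp
  then have "\<delta> > 0" using \<delta>0 by (simp add: \<delta>_def)
  moreover have "\<epsilon> * ln (norm (\<theta> - north)) \<le> v \<theta>"
    if \<theta>: "\<theta> \<in> S2" "\<theta> \<noteq> north" "norm (\<theta> - north) < \<delta>" for \<theta>
  proof -
    have "(norm (\<theta> - north))\<^sup>2 < (sqrt (2 - 2 * cos 1))\<^sup>2"
      using \<theta>(3) by (intro power_strict_mono) (auto simp: \<delta>_def)
    then have h: "cos 1 < \<theta> \<bullet> north" using norm_sub_north[OF \<theta>(1)] cos1 by simp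
    have "cos (1::real) > 0" using cos_gt_zero[of 1] pi_gt3 by simp
    have "\<theta> \<noteq> south"
    proof
      assume "\<theta> = south"
      then have "\<theta> \<bullet> north = - 1" using north_sphere(1) by (simp add: north_sphere(3))
      then show False using h \<open>cos (1::real) > 0\<close> by simp
    qed
    note b = geodesic_dist_north_bounds[OF \<theta>(1,2) this]
    have "arccos (\<theta> \<bullet> north) < arccos (cos 1)"
      using h height_bounds[OF \<theta>(1)] by (intro arccos_less_arccos) auto
    also have "arccos (cos 1) = (1::real)" using pi_gt3 by (intro arccos_cos) auto
    finally have d1: "geodesic_dist \<theta> north < 1" using b(2) by linarith
    have pos: "norm (\<theta> - north) > 0" using \<theta>(2) by simp
    then have d0: "geodesic_dist \<theta> north > 0" using b(1) by linarith
    have "v \<theta> / ln (geodesic_dist \<theta> north) < \<epsilon>" using \<delta>0(2)[OF \<theta>(1,2)] \<theta>(3) by (simp add: \<delta>_def)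
    then have "\<epsilon> * ln (geodesic_dist \<theta> north) < v \<theta>"
      using d0 d1 by (simp add: divide_less_eq)
    moreover have "\<epsilon> * ln (norm (\<theta> - north)) \<le> \<epsilon> * ln (geodesic_dist \<theta> north)"
      using \<epsilon> b(1) pos d0 by (intro mult_left_mono) auto
    ultimately show ?thesis by linarith
  qed
  ultimately show ?thesis by blast
qed

section \<open>Symmetric functions that increase along meridians\<close>

lemma rotation_same_height:
  assumes "\<theta> \<in> S2" "\<theta>' \<in> S2" "\<theta> \<bullet> north = \<theta>' \<bullet> north"
  shows "\<exists>Q::real^3^3. rotation_matrix Q \<and> Q *v north = north \<and> Q *v \<theta> = \<theta>'"
proof -
  define r where "r = (\<theta> $ 1)\<^sup>2 + (\<theta> $ 2)\<^sup>2"
  have h: "\<theta> $ 3 = \<theta>' $ 3" using assms(3) by (simp add: inner_north)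
  have "r + (\<theta> $ 3)\<^sup>2 = 1" "(\<theta>' $ 1)\<^sup>2 + (\<theta>' $ 2)\<^sup>2 + (\<theta>' $ 3)\<^sup>2 = 1"
    using S2_inner_self[OF assms(1)] S2_inner_self[OF assms(2)]
    by (simp_all add: inner_vec_def sum_3 r_def power2_eq_square)
  then have r': "(\<theta>' $ 1)\<^sup>2 + (\<theta>' $ 2)\<^sup>2 = r" using h by simp
  show ?thesis
  proof (cases "r = 0")
    case True
    then have "\<theta> $ 1 = 0" "\<theta> $ 2 = 0" "\<theta>' $ 1 = 0" "\<theta>' $ 2 = 0"
      using r' by (auto simp: r_def sum_power2_eq_zero_iff)
    then have "\<theta> = \<theta>'" using h by (simp add: vec_eq_iff forall_3)
    moreover have "rotation_matrix (mat 1 :: real^3^3)"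
      by (simp add: rotation_matrix_def orthogonal_matrix_id)
    ultimately show ?thesis by (intro exI[of _ "mat 1"]) simp
  next
    case False
    define c where "c = (\<theta> $ 1 * \<theta>' $ 1 + \<theta> $ 2 * \<theta>' $ 2) / r"
    define d where "d = (\<theta> $ 1 * \<theta>' $ 2 - \<theta> $ 2 * \<theta>' $ 1) / r"
    define Q :: "real^3^3" where "Q = vector [vector [c, - d, 0], vector [d, c, 0], vector [0, 0, 1]]"
    have "(\<theta> $ 1 * \<theta>' $ 1 + \<theta> $ 2 * \<theta>' $ 2)\<^sup>2 + (\<theta> $ 1 * \<theta>' $ 2 - \<theta> $ 2 * \<theta>' $ 1)\<^sup>2 =
      ((\<theta> $ 1)\<^sup>2 + (\<theta> $ 2)\<^sup>2) * ((\<theta>' $ 1)\<^sup>2 + (\<theta>' $ 2)\<^sup>2)" by algebra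
    also have "\<dots> = r * r" using r' by (simp add: r_def)
    finally have cd: "c\<^sup>2 + d\<^sup>2 = 1"
      using False by (simp add: c_def d_def power_divide power2_eq_square[of r] flip: add_divide_distrib)
    have "orthogonal_matrix Q" unfolding orthogonal_matrix
      using cd by (simp add: Q_def vec_eq_iff forall_3 matrix_matrix_mult_def transpose_def sum_3
          vector_3 mat_def power2_eq_square algebra_simps)
    moreover have "det Q = 1" using cd by (simp add: Q_def det_3 vector_3 power2_eq_square)
    ultimately have "rotation_matrix Q" by (simp add: rotation_matrix_def)
    moreover have "Q *v north = north"
      by (simp add: Q_def north_def vec_eq_iff forall_3 matrix_vector_mult_def sum_3 vector_3)
    moreover have "Q *v \<theta> = \<theta>'"
    proof -
      have "c * \<theta> $ 1 - d * \<theta> $ 2 = \<theta>' $ 1 * ((\<theta> $ 1)\<^sup>2 + (\<theta> $ 2)\<^sup>2) / r"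
        by (simp add: c_def d_def power2_eq_square algebra_simps flip: diff_divide_distrib)
      moreover have "d * \<theta> $ 1 + c * \<theta> $ 2 = \<theta>' $ 2 * ((\<theta> $ 1)\<^sup>2 + (\<theta> $ 2)\<^sup>2) / r"
        by (simp add: c_def d_def power2_eq_square algebra_simps flip: add_divide_distrib)
      ultimately have "c * \<theta> $ 1 - d * \<theta> $ 2 = \<theta>' $ 1" "d * \<theta> $ 1 + c * \<theta> $ 2 = \<theta>' $ 2"
        using False by (simp_all flip: r_def)
      then show ?thesis using h
        by (simp add: Q_def vec_eq_iff forall_3 matrix_vector_mult_def sum_3 vector_3)
    qed
    ultimately show ?thesis by blast
  qed
qed

text \<open>
  Walk along the great circle through \<open>\<theta>\<close> and the poles to the height of \<open>\<theta>'\<close>, then rotate about the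
  axis.
\<close>
lemma height_monotone:
  assumes sym: "axially_symmetric_on (S2 - {north}) K"
    and mono: "\<forall>C \<theta> \<theta>'. great_circle C \<and> north \<in> C \<and> south \<in> C \<and>
           \<theta> \<in> C - {north} \<and> \<theta>' \<in> C - {north} \<and> \<theta> $ 3 > \<theta>' $ 3 \<longrightarrow> K \<theta> \<ge> K \<theta>'"
    and \<theta>: "\<theta> \<in> S2 - {north}" "\<theta>' \<in> S2 - {north}" "\<theta>' \<bullet> north \<le> \<theta> \<bullet> north"
  shows "K \<theta>' \<le> K \<theta>"
proof -
  have same: "K \<theta>' = K \<theta>" if "\<theta> \<in> S2 - {north}" "\<theta>' \<in> S2 - {north}" "\<theta> \<bullet> north = \<theta>' \<bullet> north" for \<theta> \<theta>'
    using rotation_same_height[of \<theta> \<theta>'] that sym unfolding axially_symmetric_on_def by auto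
  show ?thesis
  proof (cases "\<theta>' \<bullet> north = \<theta> \<bullet> north")
    case True then show ?thesis using same[OF \<theta>(1,2)] by simp
  next
    case False
    define h where "h = \<theta>' \<bullet> north"
    have lt: "h < \<theta> \<bullet> north" using False \<theta>(3) by (simp add: h_def)
    have "\<theta> \<noteq> south"
      using height_bounds(1)[of \<theta>'] \<theta>(2) lt north_sphere(1) by (auto simp: h_def north_sphere(3))
    then obtain e where e: "e \<in> S2" "e \<bullet> north = 0"
      "\<theta> = (\<theta> \<bullet> north) *\<^sub>R north + sqrt (1 - (\<theta> \<bullet> north)\<^sup>2) *\<^sub>R e"
      using meridian_point[of \<theta>] \<theta>(1) by auto
    define P where "P = span {north, e}"
    define \<theta>2 where "\<theta>2 = h *\<^sub>R north + sqrt (1 - h\<^sup>2) *\<^sub>R e"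
    have h1: "h\<^sup>2 \<le> 1" using height_bounds(1,2)[of \<theta>'] \<theta>(2) by (simp add: h_def abs_square_le_1 abs_le_iff)
    have ee: "e \<bullet> e = 1" by (rule S2_inner_self[OF e(1)])
    have "\<theta>2 \<bullet> \<theta>2 = h\<^sup>2 * (north \<bullet> north) + (sqrt (1 - h\<^sup>2))\<^sup>2 * (e \<bullet> e)"
      using e(2) by (simp add: \<theta>2_def inner_add inner_commute[of north e] power2_eq_square)
    also have "\<dots> = 1" using h1 ee north_sphere(1) by simp
    finally have \<theta>2S: "\<theta>2 \<in> S2" unfolding in_S2 .
    have \<theta>2h: "\<theta>2 \<bullet> north = h" using e(2) north_sphere(1) by (simp add: \<theta>2_def inner_add)
    have "\<theta>2 \<noteq> north"
      using \<theta>2h lt height_bounds(2)[of \<theta>] \<theta>(1) north_sphere(1) by auto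
    have ne: "north \<noteq> e" using e(2) north_sphere(1) by auto
    have "independent {north, e}"
    proof (rule pairwise_orthogonal_independent)
      show "pairwise orthogonal {north, e}"
        using e(2) by (auto simp: pairwise_def orthogonal_def inner_commute)
      show "0 \<notin> {north, e}" using ee north_sphere(1) by auto
    qed
    then have "dim P = 2" using ne unfolding P_def by (subst dim_span_eq_card_independent) auto
    then have "great_circle (S2 \<inter> P)" unfolding great_circle_def P_def by (intro exI[of _ "span {north, e}"]) auto
    moreover have nP: "north \<in> P" and eP: "e \<in> P" by (auto simp: P_def span_base)
    moreover have "south \<in> P" unfolding north_sphere(3) P_def by (intro span_neg) (auto simp: span_base)
    moreover have "south \<in> S2" using north_sphere(2) by (simp add: north_sphere(3))
    moreover have "\<theta> \<in> P"
      by (subst e(3)) (use nP eP in \<open>auto simp: P_def intro!: span_add span_scale\<close>)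
    moreover have "\<theta>2 \<in> P"
      using nP eP by (auto simp: P_def \<theta>2_def intro!: span_add span_scale)
    ultimately have "K \<theta>2 \<le> K \<theta>"
      using mono[rule_format, of "S2 \<inter> P" \<theta> \<theta>2] \<theta>(1) \<theta>2S \<open>\<theta>2 \<noteq> north\<close> lt \<theta>2h north_sphere(2)
      by (simp add: inner_north)
    also have "K \<theta>2 = K \<theta>'"
      using same[of \<theta>' \<theta>2] \<theta>(2) \<theta>2S \<open>\<theta>2 \<noteq> north\<close> \<theta>2h by (simp add: h_def)
    finally show ?thesis .
  qed
qed

section \<open>The equation on the sphere\<close>

text \<open>
  The hypotheses of the theorem, with monotonicity and symmetry of the coefficients combined into
  monotonicity in the height \<open>\<theta> \<bullet> north\<close>, and the growth condition in the form of a lower bound.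
\<close>
locale sphere_equation =
  fixes K f v :: "real^3 \<Rightarrow> real"
  assumes cont_K: "continuous_on (S2 - {north}) K"
    and K_nonneg: "\<theta> \<in> S2 - {north} \<Longrightarrow> 0 \<le> K \<theta>"
    and f_nonneg: "\<theta> \<in> S2 - {north} \<Longrightarrow> 0 \<le> f \<theta>"
    and K_mono: "\<theta> \<in> S2 - {north} \<Longrightarrow> \<theta>' \<in> S2 - {north} \<Longrightarrow> \<theta>' \<bullet> north \<le> \<theta> \<bullet> north \<Longrightarrow> K \<theta>' \<le> K \<theta>"
    and f_mono: "\<theta> \<in> S2 - {north} \<Longrightarrow> \<theta>' \<in> S2 - {north} \<Longrightarrow> \<theta>' \<bullet> north \<le> \<theta> \<bullet> north \<Longrightarrow> f \<theta>' \<le> f \<theta>"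
    and not_const: "\<not> (f constant_on (S2 - {north}) \<and> K constant_on (S2 - {north}))"
    and C2: "C2_on_sphere (S2 - {north}) v"
    and equation: "\<theta> \<in> S2 - {north} \<Longrightarrow>
      - laplace_beltrami v \<theta> + 1 = K \<theta> * exp (2 * v \<theta>) + f \<theta>"
    and pole: "\<epsilon> > 0 \<Longrightarrow> \<exists>\<delta>>0. \<forall>\<theta>\<in>S2. \<theta> \<noteq> north \<longrightarrow> norm (\<theta> - north) < \<delta> \<longrightarrow>
      \<epsilon> * ln (norm (\<theta> - north)) \<le> v \<theta>"
begin

lemma cont_v: "continuous_on (S2 - {north}) v"
  using C2 unfolding C2_on_sphere_def continuous_on_eq_continuous_within
  by (meson Diff_subset continuous_within_subset differentiable_imp_continuous_within)

end

lemma height_gt: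
  assumes "\<theta> \<in> S2" "\<theta> \<noteq> south"
  shows "1 + \<theta> \<bullet> north > 0"
proof -
  have "\<theta> \<bullet> north \<noteq> - 1" using height_bounds(4)[OF assms(1)] assms(2) by blast
  then show ?thesis using height_bounds(1)[OF assms(1)] by linarith
qed

lemma south_mem: "south \<in> S2 - {north}"
proof -
  have "south \<bullet> north \<noteq> north \<bullet> north" using north_sphere(1) by (simp add: north_sphere(3))
  moreover have "south \<in> S2" using north_sphere(2) by (simp add: north_sphere(3))
  ultimately show ?thesis by auto
qed

context horizontal_frame
begin

lemma stereo_mem: "p \<noteq> 0 \<Longrightarrow> stereo p \<in> S2 - {north}"
  using stereo_sphere stereo_eq_north by simp

lemma factor_antimono: "norm p \<le> norm q \<Longrightarrow> factor q \<le> factor p"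
  unfolding factor_def by (intro divide_left_mono add_left_mono power_mono mult_pos_pos add_pos_nonneg) auto

lemma stereo_norm_eq: "norm p = norm q \<Longrightarrow> stereo p \<bullet> north = stereo q \<bullet> north"
  by (simp add: stereo_height factor_def)

lemma norm_stereo_sub_north: "(norm (stereo p - north))\<^sup>2 = 2 * (factor p * (norm p)\<^sup>2)"
  using norm_sub_north[OF stereo_sphere[of p]] factor_eq[of p]
  by (simp add: stereo_height algebra_simps)

lemma stereo_surj:
  assumes "\<theta> \<in> S2" "\<theta> \<noteq> south"
  defines "p \<equiv> ((\<theta> \<bullet> a) / (1 + \<theta> \<bullet> north), (\<theta> \<bullet> b) / (1 + \<theta> \<bullet> north))"
  shows "stereo p = \<theta>"
proof -
  define c where "c = \<theta> \<bullet> north"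
  have c: "1 + c > 0" unfolding c_def by (rule height_gt[OF assms(1,2)])
  have exp: "\<theta> = (\<theta> \<bullet> a) *\<^sub>R a + (\<theta> \<bullet> b) *\<^sub>R b + c *\<^sub>R north"
    unfolding c_def by (rule orthonormal_expansion) (simp_all add: frame frame')
  have "\<theta> \<bullet> \<theta> = ((\<theta> \<bullet> a) *\<^sub>R a + (\<theta> \<bullet> b) *\<^sub>R b + c *\<^sub>R north) \<bullet> \<theta>"
    by (rule arg_cong[OF exp])
  then have "(\<theta> \<bullet> a)\<^sup>2 + (\<theta> \<bullet> b)\<^sup>2 = 1 - c\<^sup>2"
    using S2_inner_self[OF assms(1)]
    by (simp add: inner_add_left inner_commute[of a \<theta>] inner_commute[of b \<theta>]
        inner_commute[of north \<theta>] power2_eq_square flip: c_def)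
  then have "(norm p)\<^sup>2 = (1 - c\<^sup>2) / (1 + c)\<^sup>2"
    unfolding norm_prod_sq by (simp add: p_def c_def power_divide flip: add_divide_distrib)
  also have "\<dots> = (1 - c) / (1 + c)"
  proof -
    have "1 - c\<^sup>2 = (1 - c) * (1 + c)" by (simp add: power2_eq_square algebra_simps)
    then show ?thesis using c by (simp add: power2_eq_square)
  qed
  finally have "1 + (norm p)\<^sup>2 = 2 / (1 + c)" using c by (simp add: field_simps)
  then have fac: "factor p = 1 + c" by (simp add: factor_def)
  have "stereo p = (\<theta> \<bullet> a) *\<^sub>R a + (\<theta> \<bullet> b) *\<^sub>R b + (1 + c) *\<^sub>R north - north"
    unfolding stereo_def fac using c by (simp add: lift_def p_def scaleR_add_right flip: c_def)
  also have "\<dots> = \<theta>" by (subst (3) exp) (simp add: scaleR_add_left)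
  finally show ?thesis .
qed

lemma factor_at_infinity: "((\<lambda>p. factor p) \<longlongrightarrow> 0) at_infinity"
proof (rule tendsto_sandwich[of "\<lambda>p. 0" _ _ "\<lambda>p. 2 * inverse (norm p)"])
  show "\<forall>\<^sub>F p in at_infinity. factor p \<le> 2 * inverse (norm p)"
    unfolding eventually_at_infinity
  proof (intro exI[of _ 1] allI impI)
    fix p :: "real \<times> real" assume p: "1 \<le> norm p"
    then have "norm p * 1 \<le> norm p * norm p" by (intro mult_left_mono) auto
    then have "norm p \<le> 1 + (norm p)\<^sup>2" unfolding power2_eq_square by linarith
    then have "2 / (1 + (norm p)\<^sup>2) \<le> 2 / norm p"
      using p by (intro divide_left_mono mult_pos_pos add_pos_nonneg) auto
    then show "factor p \<le> 2 * inverse (norm p)" by (simp add: factor_def divide_inverse)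
  qed
  have "((\<lambda>p::real \<times> real. 2 * inverse (norm p)) \<longlongrightarrow> 2 * 0) at_infinity"
    by (intro tendsto_intros tendsto_inverse_0_at_top filterlim_norm_at_top)
  then show "((\<lambda>p::real \<times> real. 2 * inverse (norm p)) \<longlongrightarrow> 0) at_infinity" by simp
qed (auto intro: always_eventually factor_pos less_imp_le)

lemma stereo_at_infinity: "(stereo \<longlongrightarrow> south) at_infinity"
proof -
  have "norm (stereo p - south) = sqrt (2 * factor p)" for p
  proof -
    have "(stereo p + north) \<bullet> (stereo p + north) = 2 * factor p"
      using S2_inner_self[OF stereo_sphere[of p]] stereo_height[of p] frame'(4)
      by (simp add: inner_add inner_commute)
    then show ?thesis by (simp add: norm_eq_sqrt_inner north_sphere(3))
  qed
  moreover have "((\<lambda>p. sqrt (2 * factor p)) \<longlongrightarrow> sqrt (2 * 0)) at_infinity"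
    by (intro tendsto_intros factor_at_infinity)
  ultimately have "((\<lambda>p. norm (stereo p - south)) \<longlongrightarrow> 0) at_infinity" by simp
  then show ?thesis by (simp add: tendsto_norm_zero_iff LIM_zero_iff)
qed

lemma tendsto_at_infinity_south:
  fixes g :: "real^3 \<Rightarrow> real"
  assumes "continuous_on (S2 - {north}) g"
  shows "((\<lambda>p. g (stereo p)) \<longlongrightarrow> g south) at_infinity"
proof (rule continuous_on_tendsto_compose[OF assms stereo_at_infinity south_mem])
  show "\<forall>\<^sub>F p in at_infinity. stereo p \<in> S2 - {north}"
    unfolding eventually_at_infinity
    by (intro exI[of _ 1] allI impI stereo_mem) auto
qed

lemma continuous_stereo: "continuous_on T stereo"
proof -
  have "1 + (norm p)\<^sup>2 \<noteq> 0" for p :: "real \<times> real"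
    using zero_le_power2[of "norm p"] by linarith
  then show ?thesis
    unfolding stereo_def[abs_def] factor_def lift_def by (intro continuous_intros) blast
qed

end

locale sphere_equation_frame = sphere_equation K f v + horizontal_frame a b
  for K f v :: "real^3 \<Rightarrow> real" and a b :: "real^3"
begin

text \<open>
  Outside a neighbourhood of the pole everything is continuous on a compact set. The planar decay
  of order \<open>\<bar>p\<bar> ^ (- 4)\<close> comes from the conformal factor alone.
\<close>
lemma decay:
  assumes "\<rho> > 0"
  shows "\<exists>C. \<forall>p. \<rho> \<le> norm p \<longrightarrow> K (stereo p) * exp (2 * v (stereo p)) \<le> C"
proof -
  define h where "h = factor (\<rho>, 0) - 1"
  define T where "T = S2 \<inter> {\<theta>. \<theta> \<bullet> north \<le> h}"
  have "factor (\<rho>, 0) < 2" using assms by (simp add: factor_def divide_less_eq add_pos_pos)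
  then have h: "h < 1" by (simp add: h_def)
  have comp: "compact T" unfolding T_def
    by (intro compact_Int_closed compact_sphere closed_Collect_le continuous_intros)
  have sub: "T \<subseteq> S2 - {north}" using h north_sphere(1) by (auto simp: T_def)
  have inT: "stereo p \<in> T" if "\<rho> \<le> norm p" for p
    using that stereo_sphere[of p] factor_antimono[of "(\<rho>, 0)" p] assms
    by (simp add: T_def h_def stereo_height)
  have "continuous_on T (\<lambda>\<theta>. K \<theta> * exp (2 * v \<theta>))"
    by (intro continuous_intros continuous_on_subset[OF cont_K sub] continuous_on_subset[OF cont_v sub])
  then have "bounded ((\<lambda>\<theta>. K \<theta> * exp (2 * v \<theta>)) ` T)"
    using comp compact_continuous_image compact_imp_bounded by blast
  then obtain C where "\<And>\<theta>. \<theta> \<in> T \<Longrightarrow> norm (K \<theta> * exp (2 * v \<theta>)) \<le> C"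
    unfolding bounded_iff by blast
  then show ?thesis using inT by (metis abs_le_D1 real_norm_def)
qed

text \<open>
  The conformal factor strictly decreases under the reflection, so equality for \<open>factor\<^sup>2 f\<close> forces
  \<open>f\<close> to vanish. Reflecting the ray of points \<open>(- t, 0)\<close> shows that the radial profile of \<open>K\<close> has
  period \<open>2 \<mu>\<close>; being monotone, it is constant. So both functions would be constant.
\<close>
lemma nondegenerate:
  assumes \<mu>: "\<mu> > 0"
  shows "\<exists>p. p \<noteq> 0 \<and> fst p < \<mu> \<and> (K (stereo (reflection \<mu> p)) \<noteq> K (stereo p) \<or>
    (factor (reflection \<mu> p))\<^sup>2 * f (stereo (reflection \<mu> p)) \<noteq> (factor p)\<^sup>2 * f (stereo p))"
proof (rule ccontr)
  assume neg: "\<not> ?thesis"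
  have eqK: "K (stereo (reflection \<mu> p)) = K (stereo p)" if "p \<noteq> 0" "fst p < \<mu>" for p
    using neg that by blast
  have eqf: "(factor (reflection \<mu> p))\<^sup>2 * f (stereo (reflection \<mu> p)) = (factor p)\<^sup>2 * f (stereo p)"
    if "p \<noteq> 0" "fst p < \<mu>" for p
    using neg that by blast
  define ray :: "real \<Rightarrow> real \<times> real" where "ray t = (- t, 0)" for t
  have ray: "ray t \<noteq> 0" "fst (ray t) < \<mu>" "norm (ray t) = t" if "t > 0" for t
    using that \<mu> by (auto simp: ray_def zero_prod_def norm_Pair)
  have refl_ray: "norm (reflection \<mu> (ray t)) = 2 * \<mu> + t" if "t > 0" for t
    using that \<mu> by (simp add: reflection_def ray_def norm_Pair)
  have same_height: "stereo p \<bullet> north = stereo (ray (norm p)) \<bullet> north" if "p \<noteq> 0" for p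
    using that by (intro stereo_norm_eq) (simp add: ray)
  have f_ray: "f (stereo (ray t)) = 0" if t: "t > 0" for t
  proof -
    let ?p = "ray t" and ?q = "reflection \<mu> (ray t)"
    have n: "norm ?p < norm ?q" using t \<mu> ray refl_ray by simp
    then have q0: "?q \<noteq> 0" by auto
    have le: "factor ?q \<le> factor ?p" using n by (intro factor_antimono) simp
    have "(norm ?p)\<^sup>2 < (norm ?q)\<^sup>2" using n by (intro power_strict_mono) auto
    then have "factor ?q \<noteq> factor ?p" using factor_eq[of ?p] factor_eq[of ?q] factor_pos[of ?p]
      by (metis add_left_cancel less_irrefl mult_left_cancel)
    then have "factor ?q < factor ?p" using le by simp
    then have lt: "(factor ?q)\<^sup>2 < (factor ?p)\<^sup>2" using factor_pos[of ?q] by (intro power_strict_mono) auto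
    have "f (stereo ?q) \<le> f (stereo ?p)"
      using le by (intro f_mono stereo_mem ray(1)[OF t] q0) (simp add: stereo_height)
    then have "(factor ?q)\<^sup>2 * f (stereo ?q) \<le> (factor ?q)\<^sup>2 * f (stereo ?p)" by (intro mult_left_mono) auto
    then have "((factor ?p)\<^sup>2 - (factor ?q)\<^sup>2) * f (stereo ?p) \<le> 0"
      using eqf[OF ray(1,2)[OF t]] by (simp add: left_diff_distrib)
    then have "f (stereo ?p) \<le> 0" using lt by (simp add: mult_le_0_iff)
    then show ?thesis using f_nonneg[OF stereo_mem[OF ray(1)[OF t]]] by simp
  qed
  have south_or_ray: "\<theta> = south \<or> (\<exists>t>0. \<theta> \<bullet> north = stereo (ray t) \<bullet> north)" if \<theta>: "\<theta> \<in> S2 - {north}" for \<theta>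
  proof (cases "\<theta> = south")
    case False
    then obtain p where p: "stereo p = \<theta>" using stereo_surj \<theta> by blast
    then have "p \<noteq> 0" using \<theta> stereo_eq_north[of p] by auto
    then show ?thesis using same_height[of p] p by (intro disjI2 exI[of _ "norm p"]) auto
  qed simp
  have f0: "f \<theta> = 0" if \<theta>: "\<theta> \<in> S2 - {north}" for \<theta>
  proof -
    (* f decreases with decreasing height, so a zero at one higher point suffices *)
    have "\<exists>t>0. \<theta> \<bullet> north \<le> stereo (ray t) \<bullet> north"
    proof (cases "\<theta> = south")
      case True
      then have "\<theta> \<bullet> north \<le> stereo (ray 1) \<bullet> north"
        using height_bounds(1)[OF stereo_sphere[of "ray 1"]] north_sphere(1) by (simp add: north_sphere(3))
      then show ?thesis by (intro exI[of _ 1]) simp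
    qed (use south_or_ray[OF \<theta>] in auto)
    then obtain t where t: "t > 0" "\<theta> \<bullet> north \<le> stereo (ray t) \<bullet> north" by blast
    then have "f \<theta> \<le> f (stereo (ray t))" by (intro f_mono \<theta> stereo_mem ray(1))
    then show ?thesis using f_ray[OF t(1)] f_nonneg[OF \<theta>] by simp
  qed
  define \<kappa> where "\<kappa> t = K (stereo (ray t))" for t
  have K_le: "K (stereo q) \<le> K (stereo p)" if "p \<noteq> 0" "norm p \<le> norm q" for p q
  proof -
    have "q \<noteq> 0" using that by auto
    then show ?thesis using factor_antimono[OF that(2)] that(1)
      by (intro K_mono stereo_mem) (auto simp: stereo_height)
  qed
  have per: "\<kappa> (t + 2 * \<mu>) = \<kappa> t" if t: "t > 0" for t
  proof -
    have t2: "2 * \<mu> + t > 0" using t \<mu> by simp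
    have "norm (ray (2 * \<mu> + t)) = norm (reflection \<mu> (ray t))" using refl_ray[OF t] ray(3)[OF t2] by simp
    then have "K (stereo (ray (2 * \<mu> + t))) = K (stereo (reflection \<mu> (ray t)))"
      using ray(1)[OF t2] by (intro antisym K_le) auto
    then show ?thesis using eqK[OF ray(1,2)[OF t]] by (simp add: \<kappa>_def add.commute)
  qed
  have per_n: "\<kappa> (t + real n * (2 * \<mu>)) = \<kappa> t" if t: "t > 0" for t n
  proof (induction n)
    case (Suc n)
    have "t + real n * (2 * \<mu>) > 0" using t \<mu> by (simp add: add_pos_nonneg)
    from per[OF this] show ?case using Suc by (simp add: algebra_simps)
  qed simp
  have \<kappa>_le: "\<kappa> t \<le> \<kappa> t'" if "t > 0" "t' > 0" for t t'
  proof -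
    obtain n where "t' < real n * (2 * \<mu>)" using reals_Archimedean3[of "2 * \<mu>"] \<mu> by auto
    then have n: "t' \<le> t + real n * (2 * \<mu>)" "t + real n * (2 * \<mu>) > 0" using that by linarith+
    have "\<kappa> t = \<kappa> (t + real n * (2 * \<mu>))" using per_n[OF that(1)] by simp
    also have "\<dots> \<le> \<kappa> t'" unfolding \<kappa>_def
      using ray(3)[OF n(2)] ray(3)[OF that(2)] n(1) by (intro K_le ray(1) that) simp
    finally show ?thesis .
  qed
  then have \<kappa>1: "\<kappa> t = \<kappa> 1" if "t > 0" for t using that by (intro antisym) auto
  have K_stereo: "K (stereo p) = \<kappa> 1" if "p \<noteq> 0" for p
  proof -
    have "K (stereo p) = K (stereo (ray (norm p)))"
      using that by (intro antisym K_le ray(1)) (auto simp: ray)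
    then show ?thesis using \<kappa>1[of "norm p"] that by (simp add: \<kappa>_def)
  qed
  have "K south = \<kappa> 1"
  proof (rule tendsto_unique[OF _ tendsto_at_infinity_south[OF cont_K]])
    show "((\<lambda>p. K (stereo p)) \<longlongrightarrow> \<kappa> 1) at_infinity"
    proof (rule tendsto_eventually)
      show "\<forall>\<^sub>F p in at_infinity. K (stereo p) = \<kappa> 1"
        unfolding eventually_at_infinity by (intro exI[of _ 1] allI impI K_stereo) auto
    qed
  qed (rule trivial_limit_at_infinity)
  have "K \<theta> = \<kappa> 1" if \<theta>: "\<theta> \<in> S2 - {north}" for \<theta>
  proof (cases "\<theta> = south")
    case False
    then obtain p where p: "stereo p = \<theta>" using stereo_surj \<theta> by blast
    then have "p \<noteq> 0" using \<theta> stereo_eq_north[of p] by auto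
    then show ?thesis using K_stereo p by blast
  qed (use \<open>K south = \<kappa> 1\<close> in simp)
  then show False using not_const f0 unfolding constant_on_def by blast
qed

text \<open>
  With \<open>u = v + ln factor\<close> the constant \<open>1\<close> in the equation, which is the curvature of the sphere,
  is absorbed by \<open>\<Delta> (ln factor) = - factor\<^sup>2\<close>.
\<close>
sublocale planar: moving_plane
  "\<lambda>p. v (stereo p) + ln (factor p)" "\<lambda>p. K (stereo p)" "\<lambda>p. (factor p)\<^sup>2 * f (stereo p)"
  "v south + ln 2"
proof
  have pos1: "1 + (norm p)\<^sup>2 > 0" for p :: "real \<times> real" by (simp add: add_pos_nonneg)
  have ln_factor: "ln (factor p) = ln 2 - ln ((norm p)\<^sup>2 + 1)" for p
    using pos1[of p] by (simp add: factor_def ln_div add.commute)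
  have exp2: "exp (2 * (v (stereo p) + ln (factor p))) = (factor p)\<^sup>2 * exp (2 * v (stereo p))" for p
    unfolding distrib_left exp_add exp_double[of "ln (factor p)"] using factor_pos[of p] by simp
  show "has_laplacian (\<lambda>p. v (stereo p) + ln (factor p))
      (- (K (stereo p) * exp (2 * (v (stereo p) + ln (factor p))) + (factor p)\<^sup>2 * f (stereo p))) p"
    if p: "p \<noteq> 0" for p
  proof -
    have "has_laplacian (\<lambda>q. v (stereo q)) ((factor p)\<^sup>2 * laplace_beltrami v (stereo p)) p"
      using C2 stereo_mem[OF p] p unfolding C2_on_sphere_def by (intro stereo_laplacian) auto
    moreover have "has_laplacian (\<lambda>q. ln ((norm q)\<^sup>2 + 1)) (4 * 1 / ((norm p)\<^sup>2 + 1)\<^sup>2) p"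
      using pos1[of p] by (intro has_laplacian_ln) (auto simp: add.commute)
    ultimately have "has_laplacian (\<lambda>q. v (stereo q) + ln (factor q))
        ((factor p)\<^sup>2 * laplace_beltrami v (stereo p) + (0 - 4 * 1 / ((norm p)\<^sup>2 + 1)\<^sup>2)) p"
      unfolding ln_factor by (intro has_laplacian_add has_laplacian_diff has_laplacian_const)
    also have "4 * 1 / ((norm p)\<^sup>2 + 1)\<^sup>2 = (factor p)\<^sup>2"
      by (simp add: factor_def power_divide add.commute)
    also have "laplace_beltrami v (stereo p) = 1 - (K (stereo p) * exp (2 * v (stereo p)) + f (stereo p))"
      using equation[OF stereo_mem[OF p]] by linarith
    also have "(factor p)\<^sup>2 * (1 - (K (stereo p) * exp (2 * v (stereo p)) + f (stereo p))) + (0 - (factor p)\<^sup>2) =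
      - (K (stereo p) * exp (2 * (v (stereo p) + ln (factor p))) + (factor p)\<^sup>2 * f (stereo p))"
      unfolding exp2 by (simp add: algebra_simps)
    finally show ?thesis .
  qed
  have cont_factor: "continuous_on T factor" for T
    unfolding factor_def[abs_def] using pos1 by (intro continuous_intros) (metis less_irrefl)
  show "continuous_on (- {0}) (\<lambda>p. v (stereo p) + ln (factor p))"
  proof (intro continuous_on_add continuous_on_ln continuous_on_compose2[OF cont_v continuous_stereo] cont_factor)
    show "stereo ` (- {0}) \<subseteq> S2 - {north}" by (intro image_subsetI stereo_mem) simp
    show "\<forall>p\<in>- {0}. factor p \<noteq> 0" by (intro ballI less_imp_neq[OF factor_pos, symmetric])
  qed
  show "0 \<le> K (stereo p)" if "p \<noteq> 0" for p using K_nonneg[OF stereo_mem[OF that]] .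
  show "0 \<le> (factor p)\<^sup>2 * f (stereo p)" if "p \<noteq> 0" for p using f_nonneg[OF stereo_mem[OF that]] by simp
  show "K (stereo q) \<le> K (stereo p)" if "p \<noteq> 0" "norm p \<le> norm q" for p q
  proof -
    have "q \<noteq> 0" using that by auto
    then show ?thesis using factor_antimono[OF that(2)] that(1)
      by (intro K_mono stereo_mem) (auto simp: stereo_height)
  qed
  show "(factor q)\<^sup>2 * f (stereo q) \<le> (factor p)\<^sup>2 * f (stereo p)" if "p \<noteq> 0" "norm p \<le> norm q" for p q
  proof -
    have q: "q \<noteq> 0" using that by auto
    have fac: "factor q \<le> factor p" by (rule factor_antimono[OF that(2)])
    then have "f (stereo q) \<le> f (stereo p)" using q that(1)
      by (intro f_mono stereo_mem) (auto simp: stereo_height)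
    then show ?thesis using fac factor_pos[of q] f_nonneg[OF stereo_mem[OF q]]
      by (intro mult_mono power_mono) auto
  qed
  show "\<exists>C. \<forall>p. \<rho> \<le> norm p \<longrightarrow>
      K (stereo p) * exp (2 * (v (stereo p) + ln (factor p))) \<le> C / (1 + (norm p)\<^sup>2)\<^sup>2" if "\<rho> > 0" for \<rho>
  proof -
    obtain C where C: "\<And>p. \<rho> \<le> norm p \<Longrightarrow> K (stereo p) * exp (2 * v (stereo p)) \<le> C"
      using decay[OF \<open>\<rho> > 0\<close>] by blast
    have "K (stereo p) * exp (2 * (v (stereo p) + ln (factor p))) \<le> (4 * C) / (1 + (norm p)\<^sup>2)\<^sup>2"
      if "\<rho> \<le> norm p" for p
    proof -
      have "(K (stereo p) * exp (2 * v (stereo p))) * (factor p)\<^sup>2 \<le> C * (factor p)\<^sup>2"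
        by (intro mult_right_mono C that) auto
      then show ?thesis unfolding exp2 by (simp add: factor_def power_divide mult_ac)
    qed
    then show ?thesis by blast
  qed
  have "((\<lambda>p. v (stereo p) + ln 2) \<longlongrightarrow> v south + ln 2) at_infinity"
    by (intro tendsto_intros tendsto_at_infinity_south cont_v)
  then show "((\<lambda>p. v (stereo p) + ln (factor p) + ln (1 + (norm p)\<^sup>2)) \<longlongrightarrow> v south + ln 2) at_infinity"
    by (simp add: ln_factor add.commute[of 1])
  show "\<exists>\<delta>>0. \<forall>p. 0 < norm p \<and> norm p < \<delta> \<longrightarrow> \<epsilon> * ln (norm p) \<le> v (stereo p) + ln (factor p)"
    if eps: "\<epsilon> > 0" for \<epsilon>
  proof -
    obtain \<delta> where \<delta>: "\<delta> > 0" "\<And>\<theta>. \<theta> \<in> S2 \<Longrightarrow> \<theta> \<noteq> north \<Longrightarrow> norm (\<theta> - north) < \<delta> \<Longrightarrow>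
        \<epsilon> * ln (norm (\<theta> - north)) \<le> v \<theta>"
      using pole[OF eps] by blast
    have "\<epsilon> * ln (norm p) \<le> v (stereo p) + ln (factor p)" if p: "0 < norm p" "norm p < min 1 (\<delta> / 2)" for p
    proof -
      let ?r = "norm p"
      have r2: "?r\<^sup>2 \<le> 1" using p by (simp add: power_le_one)
      have fac: "1 \<le> factor p" "factor p \<le> 2"
        using r2 pos1[of p] by (auto simp: factor_def le_divide_eq divide_le_eq)
      (* inside the unit disc the planar norm and the chord to the pole are comparable *)
      have "1 * ?r\<^sup>2 \<le> factor p * ?r\<^sup>2" "factor p * ?r\<^sup>2 \<le> 2 * ?r\<^sup>2"
        using fac by (intro mult_right_mono; simp)+
      then have "?r\<^sup>2 \<le> (norm (stereo p - north))\<^sup>2" "(norm (stereo p - north))\<^sup>2 \<le> (2 * ?r)\<^sup>2"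
        unfolding norm_stereo_sub_north power_mult_distrib using zero_le_power2[of ?r] by simp_all
      then have d: "?r \<le> norm (stereo p - north)" "norm (stereo p - north) \<le> 2 * ?r"
        using p by (auto intro: power2_le_imp_le)
      have "\<epsilon> * ln ?r \<le> \<epsilon> * ln (norm (stereo p - north))"
        using d(1) p(1) eps by (intro mult_left_mono ln_mono) linarith+
      also have "\<dots> \<le> v (stereo p)"
        using stereo_mem[of p] p d by (intro \<delta>(2)) auto
      also have "\<dots> \<le> v (stereo p) + ln (factor p)" using fac by simp
      finally show ?thesis .
    qed
    then show ?thesis using \<delta>(1) by (intro exI[of _ "min 1 (\<delta> / 2)"]) auto
  qed
  show "\<exists>p. p \<noteq> 0 \<and> fst p < \<mu> \<and> (K (stereo (reflection \<mu> p)) \<noteq> K (stereo p) \<or>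
    (factor (reflection \<mu> p))\<^sup>2 * f (stereo (reflection \<mu> p)) \<noteq> (factor p)\<^sup>2 * f (stereo p))" if "\<mu> > 0" for \<mu>
    using nondegenerate[OF that] .
qed

lemma stereo_reflection_inequality:
  assumes "x < 0"
  shows "v (stereo (- x, y)) \<le> v (stereo (x, y))"
  using planar.reflection_inequality[OF assms, of y] by (simp add: factor_def norm_Pair)

end

lemma horizontal_frame_exists:
  assumes "a \<bullet> a = 1" "a \<bullet> north = 0"
  shows "\<exists>b. horizontal_frame a b"
proof -
  have a3: "a $ 3 = 0" using assms(2) by (simp add: inner_north)
  have "horizontal_frame a (vector [- (a $ 2), a $ 1, 0])"
    using assms a3 by unfold_locales (simp_all add: north_def inner_vec_def sum_3 vector_3 algebra_simps)
  then show ?thesis by blast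
qed

context sphere_equation
begin

text \<open>
  In the chart with first axis \<open>a\<close>, reflection of the sphere in the plane orthogonal to \<open>a\<close> is
  \<open>(x, y) \<mapsto> (- x, y)\<close>.
\<close>
lemma vertical_reflection_le:
  assumes a: "a \<bullet> a = 1" "a \<bullet> north = 0" and \<theta>: "\<theta> \<in> S2" "\<theta> \<bullet> a < 0"
  shows "v (\<theta> - (2 * (\<theta> \<bullet> a)) *\<^sub>R a) \<le> v \<theta>"
proof -
  obtain b where "horizontal_frame a b" using horizontal_frame_exists[OF a] by blast
  then interpret horizontal_frame a b .
  interpret sphere_equation_frame K f v a b ..
  have ns: "\<theta> \<noteq> south" using \<theta>(2) a(2) by (auto simp: north_sphere(3) inner_commute)
  define c where "c = \<theta> \<bullet> north"
  have c: "1 + c > 0" unfolding c_def by (rule height_gt[OF \<theta>(1) ns])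
  define x y where "x = (\<theta> \<bullet> a) / (1 + c)" and "y = (\<theta> \<bullet> b) / (1 + c)"
  have s: "stereo (x, y) = \<theta>" using stereo_surj[OF \<theta>(1) ns] by (simp add: x_def y_def c_def)
  have fac: "factor (x, y) = 1 + c" using stereo_height[of "(x, y)"] s by (simp add: c_def)
  have "stereo (- x, y) = stereo (x, y) - (2 * (factor (x, y) * x)) *\<^sub>R a"
    by (simp add: stereo_def lift_def factor_def norm_Pair scaleR_add_right algebra_simps)
       (simp add: vec_eq_iff algebra_simps)
  also have "factor (x, y) * x = \<theta> \<bullet> a" unfolding fac using c by (simp add: x_def)
  finally have "stereo (- x, y) = \<theta> - (2 * (\<theta> \<bullet> a)) *\<^sub>R a" by (simp add: s)
  moreover have "x < 0" using \<theta>(2) c by (simp add: x_def divide_neg_pos)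
  ultimately show ?thesis using stereo_reflection_inequality[of x y] s by simp
qed

text \<open>
  The inequality for \<open>- a\<close> at the reflected point is the reverse of the inequality for \<open>a\<close>.
\<close>
lemma vertical_reflection:
  assumes a: "a \<bullet> a = 1" "a \<bullet> north = 0" and \<theta>: "\<theta> \<in> S2"
  shows "v (\<theta> - (2 * (\<theta> \<bullet> a)) *\<^sub>R a) = v \<theta>"
proof -
  have neg: "v (\<theta> - (2 * (\<theta> \<bullet> a)) *\<^sub>R a) = v \<theta>"
    if a: "a \<bullet> a = 1" "a \<bullet> north = 0" and lt: "\<theta> \<bullet> a < 0" for a
  proof (rule antisym)
    show "v (\<theta> - (2 * (\<theta> \<bullet> a)) *\<^sub>R a) \<le> v \<theta>" by (rule vertical_reflection_le[OF a \<theta> lt])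
    define \<theta>' where "\<theta>' = \<theta> - (2 * (\<theta> \<bullet> a)) *\<^sub>R a"
    have "\<theta>' \<bullet> \<theta>' = \<theta> \<bullet> \<theta>"
      using a(1) by (simp add: \<theta>'_def inner_diff inner_commute[of a \<theta>] algebra_simps)
    then have "\<theta>' \<in> S2" using S2_inner_self[OF \<theta>] unfolding in_S2 by simp
    moreover have ip: "\<theta>' \<bullet> (- a) = \<theta> \<bullet> a" using a(1) by (simp add: \<theta>'_def inner_diff)
    ultimately have "v (\<theta>' - (2 * (\<theta>' \<bullet> (- a))) *\<^sub>R (- a)) \<le> v \<theta>'"
      using a lt by (intro vertical_reflection_le) auto
    then show "v \<theta> \<le> v (\<theta> - (2 * (\<theta> \<bullet> a)) *\<^sub>R a)" unfolding ip by (simp add: \<theta>'_def)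
  qed
  consider "\<theta> \<bullet> a < 0" | "\<theta> \<bullet> a = 0" | "\<theta> \<bullet> (- a) < 0" by fastforce
  then show ?thesis
  proof cases
    case 3
    then show ?thesis using neg[of "- a"] a by simp
  qed (use neg a in auto)
qed

text \<open>
  A rotation about the axis moves each single point like the reflection in the vertical plane that
  bisects the point and its image.
\<close>
lemma axially_symmetric: "axially_symmetric_on (S2 - {north}) v"
  unfolding axially_symmetric_on_def
proof (intro allI impI ballI)
  fix Q :: "real^3^3" and \<theta>
  assume Q: "rotation_matrix Q \<and> Q *v north = north" and "\<theta> \<in> S2 - {north}"
  then have \<theta>: "\<theta> \<in> S2" by simp
  have orth: "(Q *v x) \<bullet> (Q *v y) = x \<bullet> y" for x y
  proof -
    have "orthogonal_transformation ((*v) Q)"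
      using Q by (simp add: rotation_matrix_def orthogonal_transformation_matrix)
    then show ?thesis by (simp add: orthogonal_transformation_def)
  qed
  show "v (Q *v \<theta>) = v \<theta>"
  proof (cases "Q *v \<theta> = \<theta>")
    case False
    define w where "w = Q *v \<theta> - \<theta>"
    have w: "norm w \<noteq> 0" using False by (simp add: w_def)
    define a where "a = (1 / norm w) *\<^sub>R w"
    have "w \<bullet> north = (Q *v \<theta>) \<bullet> (Q *v north) - \<theta> \<bullet> north" using Q by (simp add: w_def inner_diff)
    then have "w \<bullet> north = 0" by (simp add: orth)
    then have a: "a \<bullet> a = 1" "a \<bullet> north = 0" using w by (auto simp: a_def power2_norm_eq_inner[symmetric] power2_eq_square)
    have "(norm w)\<^sup>2 = 2 * (\<theta> \<bullet> \<theta>) - 2 * (\<theta> \<bullet> (Q *v \<theta>))"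
      using orth[of \<theta> \<theta>] by (simp add: power2_norm_eq_inner w_def inner_diff inner_commute)
    then have "2 * (\<theta> \<bullet> w) = - (norm w)\<^sup>2" by (simp add: w_def inner_diff)
    then have "(2 * (\<theta> \<bullet> a)) *\<^sub>R a = - w"
      using w by (simp add: a_def power2_eq_square)
    then have "\<theta> - (2 * (\<theta> \<bullet> a)) *\<^sub>R a = Q *v \<theta>" by (simp add: w_def)
    then show ?thesis using vertical_reflection[OF a \<theta>] by simp
  qed simp
qed

end

theorem theorem1p7:
  fixes K f v :: "real^3 \<Rightarrow> real"
  assumes "continuous_on (S2 - {north}) K"
    and "continuous_on (S2 - {north}) f"
    and "\<forall>\<theta>\<in>S2 - {north}. K \<theta> \<ge> 0"
    and "\<forall>\<theta>\<in>S2 - {north}. f \<theta> \<ge> 0"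
    and "\<forall>C \<theta> \<theta>'. great_circle C \<and> north \<in> C \<and> south \<in> C \<and>
           \<theta> \<in> C - {north} \<and> \<theta>' \<in> C - {north} \<and> \<theta> $ 3 > \<theta>' $ 3 \<longrightarrow> K \<theta> \<ge> K \<theta>'"
    and "\<forall>C \<theta> \<theta>'. great_circle C \<and> north \<in> C \<and> south \<in> C \<and>
           \<theta> \<in> C - {north} \<and> \<theta>' \<in> C - {north} \<and> \<theta> $ 3 > \<theta>' $ 3 \<longrightarrow> f \<theta> \<ge> f \<theta>'"
    and "\<not> (f constant_on (S2 - {north}) \<and> K constant_on (S2 - {north}))"
    and "axially_symmetric_on (S2 - {north}) K"
    and "axially_symmetric_on (S2 - {north}) f"
    and "C2_on_sphere (S2 - {north}) v"
    and "\<forall>\<theta>\<in>S2 - {north}.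
           - laplace_beltrami v \<theta> + 1 = K \<theta> * exp (2 * v \<theta>) + f \<theta>"
    and "Limsup (at north within S2) (\<lambda>\<theta>. ereal (v \<theta> / ln (geodesic_dist \<theta> north))) \<le> 0"
  shows "axially_symmetric_on (S2 - {north}) v"
proof -
  interpret sphere_equation K f v
  proof
    show "K \<theta>' \<le> K \<theta>" if "\<theta> \<in> S2 - {north}" "\<theta>' \<in> S2 - {north}" "\<theta>' \<bullet> north \<le> \<theta> \<bullet> north" for \<theta> \<theta>'
      by (rule height_monotone[OF assms(8) assms(5) that])
    show "f \<theta>' \<le> f \<theta>" if "\<theta> \<in> S2 - {north}" "\<theta>' \<in> S2 - {north}" "\<theta>' \<bullet> north \<le> \<theta> \<bullet> north" for \<theta> \<theta>'
      by (rule height_monotone[OF assms(9) assms(6) that])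
    show "\<exists>\<delta>>0. \<forall>\<theta>\<in>S2. \<theta> \<noteq> north \<longrightarrow> norm (\<theta> - north) < \<delta> \<longrightarrow> \<epsilon> * ln (norm (\<theta> - north)) \<le> v \<theta>"
      if "\<epsilon> > 0" for \<epsilon>
      by (rule log_lower_bound[OF assms(12) that])
  qed (use assms in auto)
  show ?thesis by (rule axially_symmetric)
qed

end
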